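(* Not every generalised Haar null set is Haar null. More precisely, if $G$ is an abelian Polish group that is not locally compact, then there exists a coanalytic generalised Haar null set $P \subset G$ that is not contained in any Borel Haar null subset of $G$.
   Context: An abelian Polish group is an abelian topological group (written additively) whose topology is separable and completely metrizable. A set $X \subset G$ is called Haar null if there exist a Borel set $B \supset X$ and a Borel probability measure $\mu$ on $G$ such that $\mu(B+g)=0$ for every $g \in G$. A set is universally measurable if it is measurable with respect to (the completion of) every Borel probability measure; Borel measures are identified with their completions. A set $X \subset G$ is called generalised Haar null if there exist a universally measurable set $B \supset X$ and a Borel probability measure $\mu$ on $G$ such that $\mu(B+g)=0$ for every $g \in G$. A set is analytic if it is a continuous image of a Borel set (of a Polish space), and coanalytic if its complement is analytic. *)

theory Defs
  imports "HOL-Probability.Probability"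
begin

definition borel_probability :: "'a::topological_space measure \<Rightarrow> bool" where
  "borel_probability \<mu> \<longleftrightarrow> prob_space \<mu> \<and> sets \<mu> = sets borel"

definition haar_null :: "'a::topological_ab_group_add set \<Rightarrow> bool" where
  "haar_null X \<longleftrightarrow>
     (\<exists>B \<mu>. B \<in> sets borel \<and> X \<subseteq> B \<and> borel_probability \<mu> \<and>
        (\<forall>g. emeasure \<mu> ((\<lambda>x. x + g) ` B) = 0))"

definition universally_measurable :: "'a::topological_space set \<Rightarrow> bool" where
  "universally_measurable B \<longleftrightarrow> (\<forall>\<mu>. borel_probability \<mu> \<longrightarrow> B \<in> sets (completion \<mu>))"

(* Membership in null_sets (rather than emeasure = 0) because emeasure is 0 on every
   non-measurable set. *)
definition generalised_haar_null :: "'a::topological_ab_group_add set \<Rightarrow> bool" where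
  "generalised_haar_null X \<longleftrightarrow>
     (\<exists>B \<mu>. universally_measurable B \<and> X \<subseteq> B \<and> borel_probability \<mu> \<and>
        (\<forall>g. (\<lambda>x. x + g) ` B \<in> null_sets (completion \<mu>)))"

definition polish_topology :: "'a topology \<Rightarrow> bool" where
  "polish_topology Z \<longleftrightarrow> completely_metrizable_space Z \<and> separable_space Z"

(* HOL cannot quantify over types inside a formula, so the Polish space Z ranges over all
   Polish topologies whose underlying set is a subset of nat => nat. As every Polish space has
   at most continuum many points, this loses no generality: see analytic_setI_polish below. *)
definition analytic_set :: "'a::topological_space set \<Rightarrow> bool" where
  "analytic_set A \<longleftrightarrow>
     (\<exists>(Z :: (nat \<Rightarrow> nat) topology) B f.
        polish_topology Z \<and> B \<in> sigma_sets (topspace Z) {U. openin Z U} \<and>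
        continuous_map (subtopology Z B) euclidean f \<and> A = f ` B)"

definition coanalytic_set :: "'a::topological_space set \<Rightarrow> bool" where
  "coanalytic_set A \<longleftrightarrow> analytic_set (- A)"

lemma polish_topology_inj_baire:
  fixes Z :: "'b topology"
  assumes "polish_topology Z"
  shows "\<exists>i :: 'b \<Rightarrow> nat \<Rightarrow> nat. inj_on i (topspace Z)"
proof -
  obtain M d where M: "Metric_space M d" and Z: "Z = Metric_space.mtopology M d"
    using assms unfolding polish_topology_def completely_metrizable_space_def by blast
  interpret Metric_space M d by (rule M)
  obtain C where C: "countable C" "C \<subseteq> M" "mtopology closure_of C = M"
    using assms unfolding polish_topology_def separable_space_def Z topspace_mtopology by blast
  define i :: "'b \<Rightarrow> nat \<Rightarrow> nat" where
    "i x k = (case prod_decode k of (n, m) \<Rightarrow>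
        if d x (from_nat_into C n) < 1 / real (Suc m) then 1 else 0)" for x k
  have "inj_on i M"
  proof (rule inj_onI, rule ccontr)
    fix x y assume xy: "x \<in> M" "y \<in> M" "i x = i y" "x \<noteq> y"
    then have "d x y / 2 > 0" by simp
    then obtain m where m: "1 / real (Suc m) < d x y / 2"
      by (metis nat_approx_posE)
    have "x \<in> mtopology closure_of C" using C xy by simp
    then have "\<forall>r>0. \<exists>y\<in>C. y \<in> mball x r"
      unfolding metric_closure_of by blast
    moreover have "1 / real (Suc m) > 0" by simp
    ultimately obtain c where c: "c \<in> C" "c \<in> mball x (1 / real (Suc m))"
      by blast
    then obtain n where n: "c = from_nat_into C n"
      using C(1) from_nat_into_surj by metis
    have cM: "c \<in> M" using c C by blast
    have lt: "d x c < 1 / real (Suc m)" using c by simp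
    have "i x (prod_encode (n, m)) = 1" using lt n by (simp add: i_def)
    then have "i y (prod_encode (n, m)) = 1" using xy by simp
    then have "d y c < 1 / real (Suc m)" using n by (simp add: i_def split: if_splits)
    with lt m triangle[OF xy(1) cM xy(2)] show False
      using commute[of y c] by linarith
  qed
  then show ?thesis unfolding Z topspace_mtopology by blast
qed

lemma analytic_setI_polish:
  fixes Z :: "'b topology" and f :: "'b \<Rightarrow> 'a::topological_space"
  assumes Z: "polish_topology Z"
    and B: "B \<in> sigma_sets (topspace Z) {U. openin Z U}"
    and f: "continuous_map (subtopology Z B) euclidean f"
  shows "analytic_set (f ` B)"
proof -
  obtain i :: "'b \<Rightarrow> nat \<Rightarrow> nat" where i: "inj_on i (topspace Z)"
    using polish_topology_inj_baire[OF Z] by blast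
  define j where "j = inv_into (topspace Z) i"
  define Y where "Y = pullback_topology (i ` topspace Z) j Z"
  have ji: "j (i x) = x" if "x \<in> topspace Z" for x
    using that i by (simp add: j_def)
  have Ytop: "topspace Y = i ` topspace Z"
    unfolding Y_def topspace_pullback_topology using ji by auto
  have cj: "continuous_map Y Z j"
    using continuous_map_pullback[OF continuous_map_id[of Z], of "i ` topspace Z" j]
    by (simp add: Y_def o_def)
  have "continuous_map Z Z (j \<circ> i)"
    using ji by (intro continuous_map_eq[OF continuous_map_id]) auto
  then have ci: "continuous_map Z Y i"
    unfolding Y_def by (intro continuous_map_pullback') auto
  have hom: "homeomorphic_maps Z Y i j"
    unfolding homeomorphic_maps_def using ci cj ji Ytop by auto
  then have "Z homeomorphic_space Y" unfolding homeomorphic_space_def by blast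
  then have "polish_topology Y"
    using Z homeomorphic_completely_metrizable_space homeomorphic_separable_space
    unfolding polish_topology_def by blast
  moreover have BZ: "B \<subseteq> topspace Z"
    using sigma_sets_into_sp[OF _ B] openin_subset by fastforce
  have jB: "j -` B \<inter> topspace Y = i ` B"
    using ji BZ Ytop by auto
  have "j \<in> topspace Y \<rightarrow> topspace Z" using cj by (simp add: continuous_map_def)
  from sigma_sets_vimage_commute[OF this, of "{U. openin Z U}"] B
  have "i ` B \<in> sigma_sets (topspace Y) {j -` A \<inter> topspace Y |A. A \<in> {U. openin Z U}}"
    unfolding jB[symmetric] by blast
  moreover have "{j -` A \<inter> topspace Y |A. A \<in> {U. openin Z U}} \<subseteq> {U. openin Y U}"
    using cj by (auto simp: Y_def openin_pullback_topology topspace_pullback_topology Ytop[unfolded Y_def])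
  ultimately have "i ` B \<in> sigma_sets (topspace Y) {U. openin Y U}"
    using sigma_sets_mono' by blast
  moreover have "continuous_map (subtopology Y (i ` B)) euclidean (f \<circ> j)"
  proof (rule continuous_map_compose[OF _ f])
    show "continuous_map (subtopology Y (i ` B)) (subtopology Z B) j"
      using cj ji BZ by (auto simp: continuous_map_in_subtopology continuous_map_from_subtopology)
  qed
  moreover have "f ` B = (f \<circ> j) ` (i ` B)"
    using ji BZ by (force simp: image_image)
  ultimately show ?thesis
    using \<open>polish_topology Y\<close> unfolding analytic_set_def by blast
qed

end

theory Submission
  imports Defs
begin

text \<open>
  Since the group is not locally compact, one can choose points \<open>g z\<close>, indexed by
  \<open>z\<close> in Baire space, and sets \<open>K z\<close> such that the translates \<open>g z + K z\<close> are
  separated: a translate of a fixed compact set \<open>C\<close>, which carries an atomless measure,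
  meets at most one of them. Moreover every compact set is contained in some \<open>K z\<close>
  where \<open>z\<close> carries arbitrary prescribed information. Picking at most one point from each
  \<open>g z + K z\<close> therefore gives a set all of whose translates are null for the measure on
  \<open>C\<close>.

  The information in \<open>z\<close> is a code of a Borel set \<open>B\<close> together with bits describing
  a measure concentrated on \<open>K z\<close>. If the code is well-founded, it can be evaluated by
  recursion: every node receives a clopen approximation of the Borel set coded there, and
  outside an open set of measure at most one half all approximations are exact. If \<open>B\<close> is
  null for the measure, this leaves a nonempty closed set of points that avoid \<open>B\<close>, and the
  lexicographically least one is picked. A Borel Haar null set cannot contain all
  points picked, as one sees by letting \<open>z\<close> code the set itself and a witnessing measure.
  The evaluation is unique for well-founded codes, so it can be quantified
  universally, and being well-founded is a coanalytic condition.
\<close>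

section \<open>Baire space as a Polish space\<close>

text \<open>The obstacle is to pick a point outside a Borel set uniquely and by a coanalytic rule.
  The complement of a Borel set need not have a lexicographically least point; a measure helps
  because it allows every countable union in the code to be cut down to a finite one, which leaves
  clopen conditions and hence a closed set. The place of the cut has to be readable from
  \<open>z\<close>, or the evaluation would not be determined. So \<open>z\<close> lists, for finite
  lists of formulas, whether the part missed by an initial segment is small; no more of the measure
  is stored than these bits. The argument is diagonal, and the order of choices matters. A Borel set
  in the plane and a measure are fixed first, their data form one sequence \<open>a\<close>, and
  only then is \<open>z\<close> chosen with \<open>a\<close> in its first components. Therefore
  nothing that is stored may depend on \<open>z\<close>. The second components stay free to enlarge
  \<open>K z\<close>. Since \<open>K z\<close> can absorb any compact set but not the whole group, a
  witnessing measure is first restricted to a compact set of positive measure.\<close>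

instantiation nat :: metric_space
begin
definition dist_nat :: "nat \<Rightarrow> nat \<Rightarrow> real" where "dist_nat m n = (if m = n then 0 else 1)"
definition uniformity_nat :: "(nat \<times> nat) filter"
  where "uniformity_nat = (INF e\<in>{0 <..}. principal {(x, y). dist x y < e})"
instance
proof
  show "open U = (\<forall>x\<in>U. eventually (\<lambda>(x', y). x' = x \<longrightarrow> y \<in> U) uniformity)" for U :: "nat set"
  proof -
    have "eventually (\<lambda>(x', y). x' = x \<longrightarrow> y \<in> U) uniformity" if "x \<in> U" for x
      unfolding uniformity_nat_def
      by (rule eventually_INF1[of 1])
        (use that in \<open>auto simp: eventually_principal dist_nat_def split: if_splits\<close>)
    then show ?thesis by (simp add: Topological_Spaces.open_discrete)
  qed
  show "uniformity = (INF e\<in>{0 <..}. principal {(x, y :: nat). dist x y < e})"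
    by (rule uniformity_nat_def)
qed (auto simp: dist_nat_def)
end

instance nat :: complete_space
proof
  fix X :: "nat \<Rightarrow> nat"
  assume "Cauchy X"
  then obtain n where "\<forall>m\<ge>n. dist (X m) (X n) < 1"
    unfolding Cauchy_def using zero_less_one le_refl by blast
  then have "\<forall>m\<ge>n. X m = X n"
    by (auto simp: dist_nat_def split: if_splits)
  then show "convergent X"
    by (intro convergentI[where L="X n"] tendsto_eventually eventually_sequentiallyI[of n]) blast
qed

text \<open>Functions from a countable type to a Polish one form a Polish space, so
  \<open>nat \<Rightarrow> nat\<close> and \<open>nat list \<Rightarrow> nat\<close> become Polish,
  and so do the products that hold all witnesses below.\<close>

instance nat :: polish_space ..
instance prod :: (polish_space, polish_space) polish_space ..

section \<open>Projections of Borel sets\<close>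

lemma continuous_on_fst_pair_coordinates:
  "continuous_on UNIV (\<lambda>p :: 'a::topological_space \<times> ('i \<Rightarrow> 'b::topological_space). (fst p, \<lambda>k. snd p (h k)))"
  by (intro continuous_on_Pair continuous_on_fst continuous_on_id
      continuous_on_coordinatewise_then_product
      continuous_on_product_then_coordinatewise[OF continuous_on_snd[OF continuous_on_id]])

text \<open>Coordinate 0 of the new witness names the index \<open>n\<close>, the other coordinates
  are a witness for \<open>C n\<close>. Closedness survives because \<open>nat\<close> is
  discrete.\<close>

lemma closed_projection_UN:
  fixes C :: "nat \<Rightarrow> ('a::topological_space \<times> (nat \<Rightarrow> nat)) set"
  assumes "\<And>n. closed (C n)"
  shows "\<exists>D :: ('a \<times> (nat \<Rightarrow> nat)) set. closed D \<and> fst ` D = (\<Union>n. fst ` C n)"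
proof -
  let ?f = "\<lambda>p :: 'a \<times> (nat \<Rightarrow> nat). (fst p, \<lambda>k. snd p (Suc k))"
  define D where "D = (\<Inter>n. {p. snd p 0 \<noteq> n} \<union> ?f -` C n)"
  have c0: "continuous_on UNIV (\<lambda>p :: 'a \<times> (nat \<Rightarrow> nat). snd p 0)"
    by (rule continuous_on_product_then_coordinatewise[OF continuous_on_snd[OF continuous_on_id]])
  have "closed ((\<lambda>p :: 'a \<times> (nat \<Rightarrow> nat). snd p 0) -` (- {n}))" for n
    by (rule closed_vimage[OF _ c0]) (simp add: closed_def Topological_Spaces.open_discrete)
  moreover have "closed (?f -` C n)" for n
    by (rule closed_vimage[OF assms continuous_on_fst_pair_coordinates])
  ultimately have "closed D"
    unfolding D_def by (intro closed_INT ballI closed_Un) (auto simp: vimage_def Compl_eq)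
  moreover have "fst ` D = (\<Union>n. fst ` C n)"
  proof safe
    fix x w assume "(x, w) \<in> D"
    then have "(x, \<lambda>k. w (Suc k)) \<in> C (w 0)" by (auto simp: D_def)
    then show "fst (x, w) \<in> (\<Union>n. fst ` C n)" by force
  next
    fix n x w assume "(x, w) \<in> C n"
    then have "(x, case_nat n w) \<in> D" by (auto simp: D_def)
    then show "fst (x, w) \<in> fst ` D" by force
  qed
  ultimately show ?thesis by blast
qed

text \<open>A single sequence, read as a matrix, stores a witness for each \<open>n\<close> in row
  \<open>n\<close>.\<close>

lemma closed_projection_INT:
  fixes C :: "nat \<Rightarrow> ('a::topological_space \<times> (nat \<Rightarrow> nat)) set"
  assumes "\<And>n. closed (C n)"
  shows "\<exists>D :: ('a \<times> (nat \<Rightarrow> nat)) set. closed D \<and> fst ` D = (\<Inter>n. fst ` C n)"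
proof -
  let ?f = "\<lambda>n. \<lambda>p :: 'a \<times> (nat \<Rightarrow> nat). (fst p, \<lambda>k. snd p (prod_encode (n, k)))"
  define D where "D = (\<Inter>n. ?f n -` C n)"
  have "closed D"
    unfolding D_def
    by (intro closed_INT ballI closed_vimage[OF assms continuous_on_fst_pair_coordinates])
  moreover have "fst ` D = (\<Inter>n. fst ` C n)"
  proof (intro subset_antisym subsetI)
    fix x assume "x \<in> fst ` D"
    then obtain w where "(x, w) \<in> D" by auto
    then have "(x, \<lambda>k. w (prod_encode (n, k))) \<in> C n" for n by (auto simp: D_def)
    then show "x \<in> (\<Inter>n. fst ` C n)" by force
  next
    fix x assume "x \<in> (\<Inter>n. fst ` C n)"
    then have "\<forall>n. \<exists>w. (x, w) \<in> C n" by force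
    then obtain w where "\<And>n. (x, w n) \<in> C n" by metis
    then have "(x, \<lambda>m. case prod_decode m of (n, k) \<Rightarrow> w n k) \<in> D" by (auto simp: D_def)
    then show "x \<in> fst ` D" by force
  qed
  ultimately show ?thesis by blast
qed

text \<open>Closed projections are stable under countable unions and intersections but not under
  complements, so the induction treats a set together with its complement.\<close>

lemma borel_set_is_closed_projection:
  fixes B :: "'a::metric_space set"
  assumes "B \<in> sets borel"
  shows "\<exists>C :: ('a \<times> (nat \<Rightarrow> nat)) set. closed C \<and> fst ` C = B"
proof -
  define \<P> where "\<P> = {B. \<exists>C :: ('a \<times> (nat \<Rightarrow> nat)) set. closed C \<and> fst ` C = B}"
  have clo: "B \<in> \<P>" if "closed B" for B
    unfolding \<P>_def using that
    by (auto intro!: exI[of _ "B \<times> (UNIV :: (nat \<Rightarrow> nat) set)"] closed_Times)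
  have UN: "(\<Union>n. B n) \<in> \<P>" if "\<And>n::nat. B n \<in> \<P>" for B
  proof -
    from that have "\<forall>n. \<exists>C :: ('a \<times> (nat \<Rightarrow> nat)) set. closed C \<and> fst ` C = B n"
      by (simp add: \<P>_def)
    then obtain C :: "nat \<Rightarrow> ('a \<times> (nat \<Rightarrow> nat)) set"
      where "\<And>n. closed (C n)" "\<And>n. fst ` C n = B n" using choice by metis
    with closed_projection_UN[of C] show ?thesis unfolding \<P>_def by auto
  qed
  have INT: "(\<Inter>n. B n) \<in> \<P>" if "\<And>n::nat. B n \<in> \<P>" for B
  proof -
    from that have "\<forall>n. \<exists>C :: ('a \<times> (nat \<Rightarrow> nat)) set. closed C \<and> fst ` C = B n"
      by (simp add: \<P>_def)
    then obtain C :: "nat \<Rightarrow> ('a \<times> (nat \<Rightarrow> nat)) set"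
      where "\<And>n. closed (C n)" "\<And>n. fst ` C n = B n" using choice by metis
    with closed_projection_INT[of C] show ?thesis unfolding \<P>_def by auto
  qed
  have "B \<in> sigma_sets UNIV (Collect closed)"
    using assms unfolding borel_eq_closed by simp
  then have "B \<in> \<P> \<and> - B \<in> \<P>"
  proof induction
    case (Basic S)
    then have S: "closed S" by simp
    show ?case
    \<comment> \<open>By convention \<open>infdist x {} = 0\<close>, so the formula for the
      complement below fails for the empty set.\<close>
    proof (cases "S = {}")
      case False
      have "- S = (\<Union>n. {x. 1 / real (Suc n) \<le> infdist x S})"
      proof safe
        fix x assume "x \<notin> S"
        then have "infdist x S > 0" using S False by (simp add: infdist_pos_not_in_closed)
        then obtain n where "1 / real (Suc n) < infdist x S" by (metis nat_approx_posE)
        then show "x \<in> (\<Union>n. {x. 1 / real (Suc n) \<le> infdist x S})" by (auto intro: less_imp_le)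
      next
        fix x n assume "x \<in> S" "1 / real (Suc n) \<le> infdist x S"
        moreover have "0 < 1 / real (Suc n)" by simp
        ultimately show False by (metis infdist_zero not_le)
      qed
      also have "\<dots> \<in> \<P>"
        by (intro UN clo closed_Collect_le continuous_intros)
      finally show ?thesis using clo[OF S] by simp
    qed (auto intro: clo)
  next
    case Empty
    then show ?case by (auto intro: clo)
  next
    case (Compl a)
    then show ?case by (simp add: Compl_eq_Diff_UNIV[symmetric])
  next
    case (Union a)
    have "- (\<Union>i. a i) = (\<Inter>i. - a i)" by blast
    with Union UN[of a] INT[of "\<lambda>i. - a i"] show ?case by simp
  qed
  then show ?thesis unfolding \<P>_def by blast
qed

section \<open>Universal measurability and analyticity of projections\<close>

lemma countable_dense_sequence:
  "\<exists>q :: nat \<Rightarrow> 'a::second_countable_topology. \<forall>U. open U \<longrightarrow> U \<noteq> {} \<longrightarrow> (\<exists>n. q n \<in> U)"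
proof -
  obtain D :: "'a set" where D: "countable D" "\<And>X. open X \<Longrightarrow> X \<noteq> {} \<Longrightarrow> \<exists>d\<in>D. d \<in> X"
    using countable_dense_setE by blast
  from D(2)[of UNIV] have "D \<noteq> {}" by auto
  then have "range (from_nat_into D) = D" using D(1) by (rule range_from_nat_into)
  then show ?thesis using D(2) by (metis rangeE)
qed

text \<open>Lusin's argument: bound the existential witness coordinate by coordinate, losing little outer
  measure at each step; the bounded witnesses form a compact set, so the limit set is closed.\<close>

lemma closed_projection_inner_approximation:
  fixes C :: "('a::metric_space \<times> 'b::polish_space) set"
  assumes C: "closed C" and M: "finite_measure M" "sets M = sets borel"
    and c: "c < outer_measure_of M (fst ` C)"
  shows "\<exists>K. closed K \<and> K \<subseteq> fst ` C \<and> c \<le> emeasure M K"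
proof -
  interpret finite_measure M by (rule M)
  have sp: "space M = UNIV" using M(2) sets_eq_imp_space_eq by fastforce
  obtain q :: "nat \<Rightarrow> 'b" where q: "\<And>U. open U \<Longrightarrow> U \<noteq> {} \<Longrightarrow> \<exists>n. q n \<in> U"
    using countable_dense_sequence by metis
  define T where "T i j = (\<Union>k\<le>j. cball (q k) (1 / 2 ^ i))" for i j :: nat
  have T_UN: "(\<Union>j. T i j) = UNIV" for i
  proof -
    have "\<exists>j. x \<in> T i j" for x
    proof -
      have "ball x (1 / 2 ^ i) \<noteq> {}" by (simp add: not_le)
      then obtain n where "q n \<in> ball x (1 / 2 ^ i)" using q by blast
      then have "x \<in> T i n" by (auto simp: T_def dist_commute intro!: bexI[of _ n])
      then show ?thesis ..
    qed
    then show ?thesis by auto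
  qed
  let ?A = "\<lambda>D. fst ` (C \<inter> UNIV \<times> D)"
  \<comment> \<open>Outer measure is continuous along increasing sequences of arbitrary sets, so at
    each scale finitely many balls of witnesses keep the outer measure above
    \<open>c\<close>.\<close>
  have "\<exists>D. \<forall>k. c < outer_measure_of M (?A (D k)) \<and> (\<exists>j. D (Suc k) = D k \<inter> T k j)"
  proof (rule dependent_nat_choice)
    show "\<exists>D. c < outer_measure_of M (?A D)" using c by (intro exI[of _ UNIV]) simp
    fix D k assume D: "c < outer_measure_of M (?A D)"
    have "incseq (\<lambda>j. ?A (D \<inter> T k j))"
      by (intro monoI image_mono Int_mono Sigma_mono) (fastforce simp: T_def)+
    then have "(SUP j. outer_measure_of M (?A (D \<inter> T k j))) = outer_measure_of M (\<Union>j. ?A (D \<inter> T k j))"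
      by (intro SUP_outer_measure_of_incseq) (simp_all add: sp)
    also have "(\<Union>j. ?A (D \<inter> T k j)) = ?A (D \<inter> (\<Union>j. T k j))" by blast
    finally have "c < (SUP j. outer_measure_of M (?A (D \<inter> T k j)))"
      using D by (simp add: T_UN)
    then obtain j where "c < outer_measure_of M (?A (D \<inter> T k j))"
      unfolding less_SUP_iff by blast
    then show "\<exists>D'. c < outer_measure_of M (?A D') \<and> (\<exists>j. D' = D \<inter> T k j)" by blast
  qed
  then obtain D where D: "\<And>k. c < outer_measure_of M (?A (D k))"
    and "\<And>k. \<exists>j. D (Suc k) = D k \<inter> T k j" by blast
  then obtain j where j: "\<And>k. D (Suc k) = D k \<inter> T k (j k)" by metis
  have dec: "decseq D" by (rule decseq_SucI) (auto simp: j)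
  define K where "K = (\<Inter>k. closure (?A (D k)))"
  \<comment> \<open>Points of \<open>K\<close> are only limits of projections. Their approximate
    witnesses form a totally bounded set, so a subsequence converges, and closedness of
    \<open>C\<close> turns the limit into a witness.\<close>
  have "K \<subseteq> fst ` C"
  proof
    fix y assume "y \<in> K"
    have "\<exists>p\<in>C. snd p \<in> D k \<and> dist (fst p) y < 1 / real (Suc k)" for k
    proof -
      have "y \<in> closure (?A (D k))" using \<open>y \<in> K\<close> by (simp add: K_def)
      moreover have "0 < 1 / real (Suc k)" by simp
      ultimately obtain a where "a \<in> ?A (D k)" "dist a y < 1 / real (Suc k)"
        unfolding closure_approachable by blast
      then obtain p where "p \<in> C" "snd p \<in> D k" "a = fst p" by auto
      then show ?thesis using \<open>dist a y < 1 / real (Suc k)\<close> by blast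
    qed
    then obtain p where p: "\<And>k. p k \<in> C" "\<And>k. snd (p k) \<in> D k" "\<And>k. dist (fst (p k)) y < 1 / real (Suc k)"
      by metis
    let ?R = "range (\<lambda>k. snd (p k))"
    have "compact (closure ?R)"
      unfolding compact_eq_totally_bounded
    proof (intro conjI allI impI)
      show "Topological_Spaces.complete (closure ?R)" by (simp add: complete_eq_closed)
      fix e :: real assume "e > 0"
      then obtain i where i: "1 / 2 ^ i < e"
        using real_arch_pow_inv[of e "1/2"] by (auto simp: power_one_over)
      \<comment> \<open>Only the witnesses with \<open>k > i\<close> are known to lie in the balls
        of scale \<open>i\<close>; the finitely many earlier ones are added as centres.\<close>
      let ?F = "q ` {..j i} \<union> (\<lambda>k. snd (p k)) ` {..i}"
      have R: "?R \<subseteq> (\<Union>x\<in>?F. cball x (1 / 2 ^ i))"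
      proof (rule image_subsetI)
        fix k
        show "snd (p k) \<in> (\<Union>x\<in>?F. cball x (1 / 2 ^ i))"
        proof (cases "k \<le> i")
          case False
          then have "D k \<subseteq> D (Suc i)" using decseqD[OF dec, of "Suc i" k] by simp
          then have "snd (p k) \<in> T i (j i)" using p(2)[of k] j[of i] by blast
          then show ?thesis unfolding T_def by blast
        next
          case True
          moreover have "snd (p k) \<in> cball (snd (p k)) (1 / 2 ^ i)" by simp
          ultimately show ?thesis by blast
        qed
      qed
      have "closure ?R \<subseteq> (\<Union>x\<in>?F. cball x (1 / 2 ^ i))"
        by (rule closure_minimal[OF R]) (intro closed_UN finite_UnI finite_imageI finite_atMost ballI closed_cball)
      also have "\<dots> \<subseteq> (\<Union>x\<in>?F. ball x e)" using i by (intro UN_mono subset_refl) auto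
      finally have "closure ?R \<subseteq> (\<Union>x\<in>?F. ball x e)" .
      moreover have "finite ?F" by simp
      ultimately show "\<exists>k. finite k \<and> closure ?R \<subseteq> (\<Union>x\<in>k. ball x e)" by blast
    qed
    then have "seq_compact (closure ?R)" by (simp add: seq_compact_eq_compact)
    moreover have "\<forall>k. snd (p k) \<in> closure ?R" by (intro allI subsetD[OF closure_subset] rangeI)
    ultimately obtain l r where r: "strict_mono r" "((\<lambda>k. snd (p k)) \<circ> r) \<longlonglongrightarrow> l"
      by (rule seq_compactE) auto
    have "(\<lambda>k. fst (p k)) \<longlonglongrightarrow> y"
    proof (rule metric_tendsto_imp_tendsto[OF LIMSEQ_inverse_real_of_nat])
      show "\<forall>\<^sub>F k in sequentially. dist (fst (p k)) y \<le> dist (inverse (real (Suc k))) 0"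
        using p(3) by (intro always_eventually allI) (simp add: inverse_eq_divide less_imp_le)
    qed
    then have "((\<lambda>k. fst (p k)) \<circ> r) \<longlonglongrightarrow> y" using r(1) by (rule LIMSEQ_subseq_LIMSEQ)
    from tendsto_Pair[OF this r(2)] have "(\<lambda>k. p (r k)) \<longlonglongrightarrow> (y, l)" by (simp add: o_def)
    from closed_sequentially[OF C _ this] p(1) have "(y, l) \<in> C" by simp
    then show "y \<in> fst ` C" by force
  qed
  moreover have "c \<le> emeasure M K"
  proof -
    have "emeasure M K = (INF k. emeasure M (closure (?A (D k))))"
      unfolding K_def
    proof (rule INF_emeasure_decseq[symmetric])
      show "range (\<lambda>k. closure (?A (D k))) \<subseteq> sets M" by (auto simp: M(2))
      show "decseq (\<lambda>k. closure (?A (D k)))"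
        by (intro antimonoI closure_mono image_mono Int_mono Sigma_mono decseqD[OF dec]) auto
    qed simp
    also have "c \<le> \<dots>"
    proof (rule INF_greatest)
      fix k
      have "outer_measure_of M (?A (D k)) \<le> outer_measure_of M (closure (?A (D k)))"
        by (intro outer_measure_of_mono closure_subset)
      then show "c \<le> emeasure M (closure (?A (D k)))" using D[of k] by (simp add: M(2))
    qed
    finally show ?thesis .
  qed
  moreover have "closed K" unfolding K_def by (intro closed_INT) auto
  ultimately show ?thesis by blast
qed

text \<open>A measurable hull of \<open>A\<close> has the outer measure of \<open>A\<close>, and a
  countable union of inner sets reaches the same value. So \<open>A\<close> is squeezed between
  measurable sets that differ by a null set.\<close>

lemma sets_completion_if_inner_approximation:
  assumes M: "finite_measure M" and A: "A \<subseteq> space M"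
    and inner: "\<And>c. c < outer_measure_of M A \<Longrightarrow> \<exists>K\<in>sets M. K \<subseteq> A \<and> c \<le> emeasure M K"
  shows "A \<in> sets (completion M)"
proof -
  interpret finite_measure M by (rule M)
  obtain E where E: "E \<in> sets M" "A \<subseteq> E" "outer_measure_of M A = emeasure M E"
    using outer_measure_of_attain[OF A] by blast
  let ?X = "emeasure M ` {K \<in> sets M. K \<subseteq> A}"
  have "?X \<noteq> {}" by auto
  from ennreal_Sup_countable_SUP[OF this] obtain f :: "nat \<Rightarrow> ennreal"
    where f: "range f \<subseteq> ?X" "Sup ?X = (SUP i. f i)" by blast
  then have "\<forall>n. \<exists>K. K \<in> sets M \<and> K \<subseteq> A \<and> f n = emeasure M K" by blast
  then obtain K where K: "\<And>n. K n \<in> sets M" "\<And>n. K n \<subseteq> A" "\<And>n. f n = emeasure M (K n)" by metis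
  let ?K = "\<Union>n. K n"
  have Km: "?K \<in> sets M" using K(1) by blast
  have "emeasure M E \<le> Sup ?X"
  proof (rule dense_le)
    fix c assume "c < emeasure M E"
    then show "c \<le> Sup ?X" using inner[of c] E(3) by (auto intro: Sup_upper2)
  qed
  also have "\<dots> \<le> emeasure M ?K"
    unfolding f(2) K(3) by (intro SUP_least emeasure_mono Km) auto
  finally have "emeasure M E \<le> emeasure M ?K" .
  moreover have "?K \<subseteq> E" using K(2) E(2) by blast
  ultimately have "emeasure M (E - ?K) = 0"
    using E Km by (subst emeasure_Diff) (auto simp: diff_eq_0_iff_ennreal less_top[symmetric])
  then have "E - ?K \<in> null_sets M" using E Km by auto
  moreover have "A = ?K \<union> (A - ?K)" "A - ?K \<subseteq> E - ?K" using K(2) E(2) by auto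
  ultimately show ?thesis
    unfolding sets_completion using Km by blast
qed

lemma projection_borel_universally_measurable:
  fixes D :: "('a::polish_space \<times> 'b::polish_space) set"
  assumes "D \<in> sets borel"
  shows "universally_measurable (fst ` D)"
  unfolding universally_measurable_def borel_probability_def
proof safe
  fix M :: "'a measure" assume M: "prob_space M" "sets M = sets borel"
  then have fin: "finite_measure M" by (simp add: prob_space_def)
  obtain C :: "(('a \<times> 'b) \<times> (nat \<Rightarrow> nat)) set" where C: "closed C" "fst ` C = D"
    using borel_set_is_closed_projection[OF assms] by blast
  define C' where "C' = (\<lambda>p :: 'a \<times> ('b \<times> (nat \<Rightarrow> nat)). ((fst p, fst (snd p)), snd (snd p))) -` C"
  have "closed C'"
    unfolding C'_def by (intro closed_vimage C continuous_intros)
  have "fst ` D = fst ` C'"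
  proof safe
    fix x y assume "(x, y) \<in> D"
    then obtain w where "((x, y), w) \<in> C" using C(2) by force
    then have "(x, y, w) \<in> C'" by (simp add: C'_def)
    then show "fst (x, y) \<in> fst ` C'" by force
  next
    fix x y w assume "(x, y, w) \<in> C'"
    then have "(x, y) \<in> D" unfolding C(2)[symmetric] C'_def by force
    then show "fst (x, y, w) \<in> fst ` D" by force
  qed
  moreover have "fst ` C' \<in> sets (completion M)"
  proof (rule sets_completion_if_inner_approximation[OF fin])
    show "fst ` C' \<subseteq> space M" by (simp add: sets_eq_imp_space_eq[OF M(2)])
    fix c assume "c < outer_measure_of M (fst ` C')"
    from closed_projection_inner_approximation[OF \<open>closed C'\<close> fin M(2) this]
    show "\<exists>K\<in>sets M. K \<subseteq> fst ` C' \<and> c \<le> emeasure M K"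
      unfolding M(2) using borel_closed by blast
  qed
  ultimately show "fst ` D \<in> sets (completion M)" by simp
qed

lemma projection_borel_analytic:
  fixes D :: "('a::polish_space \<times> 'b::polish_space) set"
  assumes "D \<in> sets borel"
  shows "analytic_set (fst ` D)"
proof (rule analytic_setI_polish)
  obtain S :: "('a \<times> 'b) set" where S: "countable S" "\<And>X. open X \<Longrightarrow> X \<noteq> {} \<Longrightarrow> \<exists>d\<in>S. d \<in> X"
    using countable_dense_setE by blast
  have "closure S = UNIV"
    using S(2)[of "- closure S"] closure_subset[of S] by blast
  with S(1) have "separable_space (euclidean :: ('a \<times> 'b) topology)"
    unfolding separable_space_def by (intro exI[of _ S]) simp
  then show "polish_topology (euclidean :: ('a \<times> 'b) topology)"
    by (simp add: polish_topology_def completely_metrizable_space_euclidean)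
  show "D \<in> sigma_sets (topspace euclidean) {U. openin euclidean U}"
    using assms by (simp add: borel_def)
  show "continuous_map (subtopology euclidean D) euclidean fst"
    by (simp add: continuous_map_iff_continuous continuous_on_fst)
qed

section \<open>Polish groups that are not locally compact\<close>

lemma closed_symmetric_half_neighbourhood:
  fixes U :: "'a::{topological_ab_group_add, metric_space} set"
  assumes "open U" "0 \<in> U"
  shows "\<exists>N. closed N \<and> 0 \<in> interior N \<and> (\<forall>x\<in>N. - x \<in> N) \<and> (\<forall>x\<in>N. \<forall>y\<in>N. x + y \<in> U)"
proof -
  have "open ((\<lambda>p :: 'a \<times> 'a. fst p + snd p) -` U)"
    by (intro open_vimage assms continuous_intros)
  moreover have "(0, 0) \<in> (\<lambda>p :: 'a \<times> 'a. fst p + snd p) -` U" using assms by simp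
  ultimately obtain A B where AB: "open A" "open B" "(0, 0) \<in> A \<times> B"
    "A \<times> B \<subseteq> (\<lambda>p. fst p + snd p) -` U"
    by (rule open_prod_elim)
  then have "open (A \<inter> B)" "0 \<in> A \<inter> B" by auto
  then obtain e where e: "e > 0" "cball 0 e \<subseteq> A \<inter> B"
    using open_contains_cball by blast
  \<comment> \<open>The metric need not be invariant, so a ball around \<open>0\<close> need not be
    symmetric; its intersection with the reflected ball is.\<close>
  define N where "N = cball 0 e \<inter> uminus -` cball (0 :: 'a) e"
  have "closed N"
    unfolding N_def by (intro closed_Int closed_cball closed_vimage continuous_intros)
  moreover have "ball 0 e \<inter> uminus -` ball (0 :: 'a) e \<subseteq> interior N"
    by (intro interior_maximal open_Int open_ball open_vimage continuous_intros) (auto simp: N_def)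
  then have "0 \<in> interior N" using e(1) by auto
  moreover have "x + y \<in> U" if "x \<in> N" "y \<in> N" for x y
  proof -
    have "(x, y) \<in> A \<times> B" using that e(2) by (auto simp: N_def)
    then show ?thesis using AB(4) by auto
  qed
  ultimately show ?thesis by (intro exI[of _ N]) (auto simp: N_def)
qed

lemma open_translate:
  fixes U :: "'a::topological_ab_group_add set"
  assumes "open U"
  shows "open {x. a + x \<in> U}" "open {x. x - a \<in> U}" "open {x. a - x \<in> U}"
proof -
  have "open ((\<lambda>x. a + x) -` U)" "open ((\<lambda>x. x - a) -` U)" "open ((\<lambda>x. a - x) -` U)"
    by (intro open_vimage assms continuous_intros)+
  then show "open {x. a + x \<in> U}" "open {x. x - a \<in> U}" "open {x. a - x \<in> U}"
    by (simp_all add: vimage_def)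
qed

text \<open>The given complete metric need not be invariant; by Baire category a generic translate
  of a sequence that is Cauchy for the group structure is Cauchy for the metric.\<close>

lemma group_Cauchy_convergent:
  fixes x :: "nat \<Rightarrow> 'a::{topological_ab_group_add, polish_space}"
  assumes Cau: "\<And>U. open U \<Longrightarrow> 0 \<in> U \<Longrightarrow> \<exists>M. \<forall>m\<ge>M. \<forall>n\<ge>M. x m - x n \<in> U"
  shows "convergent x"
proof -
  \<comment> \<open>Around such \<open>h\<close>, translation brings a tail of \<open>x\<close>
    within \<open>1 / real (Suc k)\<close> of itself. A point common to all \<open>\<O> k\<close> is
    the generic translate.\<close>
  define \<O> where "\<O> k = {h. \<exists>U m. open U \<and> h \<in> U \<and>
      (\<forall>n\<ge>m. \<forall>n'\<ge>m. \<forall>u\<in>U. dist (x n + u) (x n' + u) < 1 / real (Suc k))}" for k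
  have "open (\<O> k)" for k
    unfolding open_subopen[of "\<O> k"]
  proof
    fix h assume "h \<in> \<O> k"
    then obtain U m where "open U" "h \<in> U"
      "\<forall>n\<ge>m. \<forall>n'\<ge>m. \<forall>u\<in>U. dist (x n + u) (x n' + u) < 1 / real (Suc k)"
      unfolding \<O>_def by blast
    then show "\<exists>T. open T \<and> h \<in> T \<and> T \<subseteq> \<O> k" unfolding \<O>_def by blast
  qed
  moreover have "closure (\<O> k) = UNIV" for k
  proof -
    have "\<exists>h\<in>\<O> k. h \<in> W" if W: "open W" "a \<in> W" for W a
    proof -
      obtain M where M: "\<And>m n. m \<ge> M \<Longrightarrow> n \<ge> M \<Longrightarrow> x m - x n \<in> {w. a + w \<in> W}"
        using Cau[OF open_translate(1)[OF W(1), of a]] W(2) by auto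
      define b where "b = a + x M"
      define r where "r = 1 / (2 * real (Suc k))"
      have "open {w. b + w \<in> ball b r}" "0 \<in> {w. b + w \<in> ball b r}"
        by (intro open_translate open_ball) (simp add: r_def)
      from closed_symmetric_half_neighbourhood[OF this] obtain N
        where N: "0 \<in> interior N" "\<And>u v. u \<in> N \<Longrightarrow> v \<in> N \<Longrightarrow> b + (u + v) \<in> ball b r"
        by auto
      obtain M1 where M1: "\<And>m n. m \<ge> M1 \<Longrightarrow> n \<ge> M1 \<Longrightarrow> x m - x n \<in> interior N"
        using Cau[OF open_interior N(1)] by auto
      define M' where "M' = max M M1"
      \<comment> \<open>Now \<open>x i + h\<close> equals \<open>b + (x i - x M')\<close>, which
        stays near the fixed point \<open>b\<close>, where continuity of addition controls the
        metric.\<close>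
      define h where "h = b - x M'"
      have "h = a + (x M - x M')" by (simp add: h_def b_def)
      then have "h \<in> W" using M[of M M'] by (simp add: M'_def)
      have "h \<in> \<O> k"
        unfolding \<O>_def
      proof (intro CollectI exI conjI allI impI ballI)
        show "open {u. u - h \<in> interior N}" by (intro open_translate open_interior)
        show "h \<in> {u. u - h \<in> interior N}" using N(1) by simp
        fix n n' u assume n: "n \<ge> M'" "n' \<ge> M'" and u: "u \<in> {u. u - h \<in> interior N}"
        have "x i + u \<in> ball b r" if "i \<ge> M'" for i
        proof -
          have "x i - x M' \<in> N" "u - h \<in> N"
            using M1[of i M'] that u interior_subset by (auto simp: M'_def)
          then have "b + ((x i - x M') + (u - h)) \<in> ball b r" by (rule N(2))
          then show ?thesis by (simp add: h_def algebra_simps)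
        qed
        from this[OF n(1)] this[OF n(2)] have "dist (x n + u) (x n' + u) < r + r"
          using dist_triangle3[of "x n + u" "x n' + u" b] by simp
        then show "dist (x n + u) (x n' + u) < 1 / real (Suc k)" by (simp add: r_def field_simps)
      qed
      with \<open>h \<in> W\<close> show ?thesis by blast
    qed
    then show ?thesis using closure_subset by (metis Compl_iff UNIV_eq_I closed_closure open_Compl subsetD)
  qed
  ultimately have "euclidean closure_of (\<Inter>(range \<O>)) = topspace (euclidean :: 'a topology)"
    by (intro Baire_category) (auto simp: completely_metrizable_space_euclidean)
  then have "(\<Inter>k. \<O> k) \<noteq> {}" by auto
  then obtain h where h: "\<And>k. h \<in> \<O> k" by blast
  have "Cauchy (\<lambda>n. x n + h)"
  proof (rule metric_CauchyI)
    fix e :: real assume "e > 0"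
    then obtain k where k: "1 / real (Suc k) < e" by (metis nat_approx_posE)
    from h[of k] obtain m where "\<forall>n\<ge>m. \<forall>n'\<ge>m. dist (x n + h) (x n' + h) < 1 / real (Suc k)"
      unfolding \<O>_def by blast
    with k show "\<exists>M. \<forall>m\<ge>M. \<forall>n\<ge>M. dist (x m + h) (x n + h) < e" by (meson less_trans)
  qed
  then obtain l where "(\<lambda>n. x n + h) \<longlonglongrightarrow> l" using Cauchy_convergent convergent_def by blast
  then have "(\<lambda>n. x n + h - h) \<longlonglongrightarrow> l - h" by (intro tendsto_intros)
  then show ?thesis by (auto simp: convergent_def)
qed

text \<open>By pigeonhole a subsequence lies in one small translate, so its differences are small; a
  diagonal subsequence is then Cauchy for the group structure. Its limit comes from
  \<open>group_Cauchy_convergent\<close>, as metric and group smallness need not agree away from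
  \<open>0\<close>.\<close>

lemma compact_if_group_totally_bounded:
  fixes S :: "'a::{topological_ab_group_add, polish_space} set"
  assumes S: "closed S"
    and tb: "\<And>W. open W \<Longrightarrow> 0 \<in> W \<Longrightarrow> \<exists>F. finite F \<and> S \<subseteq> (\<Union>f\<in>F. {x. x - f \<in> W})"
  shows "compact S"
  unfolding seq_compact_eq_compact[symmetric] seq_compact_def
proof (intro allI impI)
  fix x :: "nat \<Rightarrow> 'a" assume x: "\<forall>n. x n \<in> S"
  define P where "P n s \<longleftrightarrow> (\<forall>i j. x (s i) - x (s j) \<in> ball 0 (1 / real (Suc n)))"
    for n and s :: "nat \<Rightarrow> nat"
  interpret subseqs P
  proof
    fix n and s :: "nat \<Rightarrow> nat" assume "strict_mono s"
    have "(0 :: 'a) \<in> ball 0 (1 / real (Suc n))" by simp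
    from closed_symmetric_half_neighbourhood[OF open_ball this]
    obtain N where N: "0 \<in> interior N" "\<And>u. u \<in> N \<Longrightarrow> - u \<in> N"
      "\<And>u v. u \<in> N \<Longrightarrow> v \<in> N \<Longrightarrow> u + v \<in> ball (0 :: 'a) (1 / real (Suc n))"
      by blast
    obtain F where F: "finite F" "S \<subseteq> (\<Union>f\<in>F. {x. x - f \<in> interior N})"
      using tb[OF open_interior N(1)] by blast
    have "\<forall>i. \<exists>f. f \<in> F \<and> x (s i) - f \<in> N" using F(2) x interior_subset by blast
    then obtain f where f: "\<And>i. f i \<in> F" "\<And>i. x (s i) - f i \<in> N" by metis
    have "finite (range f)" using f(1) F(1) by (meson finite_subset image_subsetI)
    then obtain i0 where inf: "infinite {i. f i = f i0}"
      using pigeonhole_infinite[of "UNIV :: nat set" f] by auto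
    define r where "r = enumerate {i. f i = f i0}"
    have "strict_mono r" unfolding r_def using inf by (rule strict_mono_enumerate)
    moreover have r: "f (r i) = f i0" for i
      using enumerate_in_set[OF inf] by (auto simp: r_def)
    have "P n (s \<circ> r)"
      unfolding P_def
    proof (intro allI)
      fix i j
      have "(x (s (r i)) - f i0) + - (x (s (r j)) - f i0) \<in> ball 0 (1 / real (Suc n))"
        using f(2)[of "r i"] f(2)[of "r j"] by (intro N) (simp_all only: r)
      then show "x ((s \<circ> r) i) - x ((s \<circ> r) j) \<in> ball 0 (1 / real (Suc n))" by simp
    qed
    ultimately show "\<exists>r'. strict_mono r' \<and> P n (s \<circ> r')" by blast
  qed
  have hold: "P k (diagseq \<circ> (+) (Suc k))" for k
    by (rule diagseq_holds) (auto simp: P_def)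
  have "convergent (x \<circ> diagseq)"
  proof (rule group_Cauchy_convergent)
    fix U :: "'a set" assume "open U" "0 \<in> U"
    then obtain e where e: "e > 0" "ball 0 e \<subseteq> U" using open_contains_ball by blast
    then obtain k where k: "1 / real (Suc k) < e" by (metis nat_approx_posE)
    have "x (diagseq m) - x (diagseq n) \<in> U" if "m \<ge> Suc k" "n \<ge> Suc k" for m n
    proof -
      have "x ((diagseq \<circ> (+) (Suc k)) (m - Suc k)) - x ((diagseq \<circ> (+) (Suc k)) (n - Suc k))
          \<in> ball 0 (1 / real (Suc k))"
        using hold[of k] unfolding P_def by blast
      then show ?thesis using that k e(2) by (auto simp: subset_iff)
    qed
    then show "\<exists>M. \<forall>m\<ge>M. \<forall>n\<ge>M. (x \<circ> diagseq) m - (x \<circ> diagseq) n \<in> U" by auto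
  qed
  then obtain l where l: "(x \<circ> diagseq) \<longlonglongrightarrow> l" by (auto simp: convergent_def)
  moreover have "l \<in> S" using closed_sequentially[OF S _ l] x by simp
  ultimately show "\<exists>l\<in>S. \<exists>r. strict_mono r \<and> (x \<circ> r) \<longlonglongrightarrow> l"
    using subseq_diagseq by blast
qed

text \<open>Otherwise \<open>S\<close> would be compact, and its translates would be compact
  neighbourhoods of all points.\<close>

lemma not_locally_compact_not_totally_bounded:
  fixes S :: "'a::{topological_ab_group_add, polish_space} set"
  assumes nlc: "\<not> locally_compact_space (euclidean :: 'a topology)"
    and S: "closed S" "0 \<in> interior S"
  shows "\<exists>W. open W \<and> 0 \<in> W \<and> (\<forall>F. finite F \<longrightarrow> \<not> S \<subseteq> (\<Union>f\<in>F. {x. x - f \<in> W}))"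
proof (rule ccontr)
  assume "\<not> ?thesis"
  then have "compact S" by (intro compact_if_group_totally_bounded S(1)) blast
  have "locally_compact_space (euclidean :: 'a topology)"
    unfolding locally_compact_space_def
  proof
    fix a :: 'a
    have "compact ((+) a ` S)"
      by (intro compact_continuous_image \<open>compact S\<close> continuous_intros)
    moreover have "{x. x - a \<in> interior S} \<subseteq> (+) a ` S"
    proof
      fix x assume "x \<in> {x. x - a \<in> interior S}"
      then have "x - a \<in> S" using interior_subset by auto
      then have "a + (x - a) \<in> (+) a ` S" by (rule imageI)
      then show "x \<in> (+) a ` S" by simp
    qed
    ultimately show "\<exists>U K. openin euclidean U \<and> compactin euclidean K \<and> a \<in> U \<and> U \<subseteq> K"
      using S(2) open_translate(2)[OF open_interior, of a S]
      by (intro exI[of _ "{x. x - a \<in> interior S}"] exI[of _ "(+) a ` S"]) simp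
  qed
  with nlc show False by contradiction
qed

text \<open>The last clause is the form in which the failure of local compactness is used:
  \<open>L + V (Suc n)\<close> never covers \<open>V n\<close> for compact \<open>L\<close>.\<close>

definition separating_neighbourhoods :: "(nat \<Rightarrow> 'a::{topological_ab_group_add, metric_space} set) \<Rightarrow> bool" where
  "separating_neighbourhoods V \<longleftrightarrow>
     (\<forall>n. closed (V n) \<and> 0 \<in> interior (V n) \<and> (\<forall>x\<in>V n. - x \<in> V n) \<and> V n \<subseteq> ball 0 (1 / real (Suc n)) \<and>
       (\<forall>x\<in>V (Suc n). \<forall>y\<in>V (Suc n). x + y \<in> V n) \<and>
       (\<forall>L. compact L \<longrightarrow> (\<exists>v\<in>V n. \<forall>l\<in>L. v - l \<notin> V (Suc n))))"

text \<open>Let no finitely many translates of \<open>W\<close> cover \<open>V\<close>, and let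
  \<open>N + N\<close> lie in \<open>W\<close>. If \<open>L + N\<close> covered \<open>V\<close>
  with \<open>L\<close> compact, finitely many translates of \<open>N\<close> would cover
  \<open>L\<close>, and the same translates of \<open>W\<close> would cover
  \<open>V\<close>.\<close>

lemma separating_neighbourhoods_exist:
  assumes nlc: "\<not> locally_compact_space (euclidean :: 'a::{topological_ab_group_add, polish_space} topology)"
  shows "\<exists>V :: nat \<Rightarrow> 'a set. separating_neighbourhoods V"
proof -
  let ?P = "\<lambda>n V. closed V \<and> 0 \<in> interior V \<and> (\<forall>x\<in>V. - x \<in> V) \<and> V \<subseteq> ball (0 :: 'a) (1 / real (Suc n))"
  let ?Q = "\<lambda>V V'. (\<forall>x\<in>V'. \<forall>y\<in>V'. x + y \<in> V) \<and>
     (\<forall>L. compact L \<longrightarrow> (\<exists>v\<in>V. \<forall>l\<in>L. v - l \<notin> V'))"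
  have half: "\<exists>N. closed N \<and> 0 \<in> interior N \<and> (\<forall>x\<in>N. - x \<in> N) \<and> N \<subseteq> U \<and> (\<forall>x\<in>N. \<forall>y\<in>N. x + y \<in> U)"
    if "open U" "0 \<in> U" for U :: "'a set"
  proof -
    obtain N where N: "closed N" "0 \<in> interior N" "\<forall>x\<in>N. - x \<in> N" "\<forall>x\<in>N. \<forall>y\<in>N. x + y \<in> U"
      using closed_symmetric_half_neighbourhood[OF \<open>open U\<close> \<open>0 \<in> U\<close>] by blast
    moreover have "0 \<in> N" using N(2) interior_subset by blast
    with N(4) have "N \<subseteq> U" by (metis add_0 subsetI)
    ultimately show ?thesis by blast
  qed
  have "\<exists>V. \<forall>n. ?P n (V n) \<and> ?Q (V n) (V (Suc n))"
  proof (rule dependent_nat_choice)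
    show "\<exists>V. ?P 0 V" using half[of "ball 0 (1 / real (Suc 0))"] by auto
    fix V n assume V: "?P n V"
    obtain W where W: "open W" "0 \<in> W" "\<And>F. finite F \<Longrightarrow> \<not> V \<subseteq> (\<Union>f\<in>F. {x. x - f \<in> W})"
      using not_locally_compact_not_totally_bounded[OF nlc, of V] V by blast
    have "open (W \<inter> interior V \<inter> ball 0 (1 / real (Suc (Suc n))))"
      "0 \<in> W \<inter> interior V \<inter> ball 0 (1 / real (Suc (Suc n)))"
      using V W by auto
    from half[OF this] obtain N where N: "closed N" "0 \<in> interior N" "\<forall>x\<in>N. - x \<in> N"
      "N \<subseteq> ball 0 (1 / real (Suc (Suc n)))" "\<And>x y. x \<in> N \<Longrightarrow> y \<in> N \<Longrightarrow> x + y \<in> W"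
      "\<And>x y. x \<in> N \<Longrightarrow> y \<in> N \<Longrightarrow> x + y \<in> interior V"
      by auto
    have "\<exists>v\<in>V. \<forall>l\<in>L. v - l \<notin> N" if L: "compact L" for L
    proof (rule ccontr)
      assume neg: "\<not> ?thesis"
      have "L \<subseteq> (\<Union>f\<in>L. {x. x - f \<in> interior N})" using N(2) by auto
      then obtain F where F: "F \<subseteq> L" "finite F" "L \<subseteq> (\<Union>f\<in>F. {x. x - f \<in> interior N})"
        using compactE_image[OF L, of L "\<lambda>f. {x. x - f \<in> interior N}"] open_translate(2)[OF open_interior]
        by metis
      have "V \<subseteq> (\<Union>f\<in>F. {x. x - f \<in> W})"
      proof
        fix v assume "v \<in> V"
        then obtain l where l: "l \<in> L" "v - l \<in> N" using neg by blast
        then obtain f where f: "f \<in> F" "l - f \<in> N" using F(3) interior_subset by blast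
        have "(v - l) + (l - f) \<in> W" using l f by (intro N)
        then show "v \<in> (\<Union>f\<in>F. {x. x - f \<in> W})" using f(1) by auto
      qed
      then show False using W(3) F(2) by blast
    qed
    moreover have "\<forall>x\<in>N. \<forall>y\<in>N. x + y \<in> V" using N(6) interior_subset by blast
    ultimately show "\<exists>V'. ?P (Suc n) V' \<and> ?Q V V'" using N by (intro exI[of _ N]) auto
  qed
  then show ?thesis unfolding separating_neighbourhoods_def by (auto intro!: exI)
qed

lemma compact_finite_differences:
  fixes C :: "'a::topological_ab_group_add set"
  assumes "compact C"
  shows "compact {c - c' + (q k - q l) | c c' k l. c \<in> C \<and> c' \<in> C \<and> k \<le> (i :: nat) \<and> l \<le> i}"
proof -
  have "{c - c' + (q k - q l) | c c' k l. c \<in> C \<and> c' \<in> C \<and> k \<le> i \<and> l \<le> i}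
      = (\<lambda>p. fst p - fst (snd p) + snd (snd p)) ` (C \<times> C \<times> (\<lambda>p. q (fst p) - q (snd p)) ` ({..i} \<times> {..i}))"
    by (force simp: image_iff)
  also have "compact \<dots>"
    by (intro compact_continuous_image compact_Times assms finite_imp_compact finite_imageI
        finite_cartesian_product finite_atMost continuous_intros)
  finally show ?thesis .
qed

text \<open>Greedy choice: the sets \<open>\<gamma> j + L i\<close> with \<open>j < i\<close> have a
  compact union, which the next term can avoid by a margin \<open>V'\<close>.\<close>

lemma separated_sequence_exists:
  fixes V V' :: "'a::topological_ab_group_add set"
  assumes V: "\<And>L. compact L \<Longrightarrow> \<exists>v\<in>V. \<forall>l\<in>L. v - l \<notin> V'"
    and L: "\<And>i. compact (L i)"
  shows "\<exists>\<gamma> :: nat \<Rightarrow> 'a. \<forall>i. \<gamma> i \<in> V \<and> (\<forall>j<i. \<forall>l\<in>L i. \<gamma> i - \<gamma> j - l \<notin> V')"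
proof (rule dependent_wellorder_choice)
  fix i and \<gamma> :: "nat \<Rightarrow> 'a"
  have "compact (\<Union>j<i. (+) (\<gamma> j) ` L i)"
    by (intro compact_UN finite_lessThan compact_continuous_image L continuous_intros)
  from V[OF this] obtain v where v: "v \<in> V" "\<forall>l\<in>\<Union>j<i. (+) (\<gamma> j) ` L i. v - l \<notin> V'" by blast
  have "v - \<gamma> j - l \<notin> V'" if "j < i" "l \<in> L i" for j l
  proof -
    have "v - (\<gamma> j + l) \<notin> V'" using v(2) that by blast
    then show ?thesis by (simp add: diff_diff_eq)
  qed
  with v(1) show "\<exists>v. v \<in> V \<and> (\<forall>j<i. \<forall>l\<in>L i. v - \<gamma> j - l \<notin> V')" by blast
qed simp

lemma tendsto_groupI:
  fixes f :: "'b \<Rightarrow> 'a::{topological_ab_group_add, metric_space}"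
  assumes "\<And>U. open U \<Longrightarrow> 0 \<in> U \<Longrightarrow> \<exists>n. V n \<subseteq> U"
    and "\<And>n. eventually (\<lambda>x. f x - l \<in> V n) F"
  shows "(f \<longlongrightarrow> l) F"
proof (rule topological_tendstoI)
  fix U assume "open U" "l \<in> U"
  then obtain n where n: "V n \<subseteq> {w. l + w \<in> U}" using assms(1)[OF open_translate(1)] by force
  show "eventually (\<lambda>x. f x \<in> U) F"
    using assms(2)[of n] by eventually_elim (use n in fastforce)
qed

lemma baire_tendsto_iff:
  fixes z :: "'b \<Rightarrow> nat \<Rightarrow> nat"
  shows "(z \<longlongrightarrow> w) F \<longleftrightarrow> (\<forall>n. eventually (\<lambda>k. z k n = w n) F)"
  unfolding limitin_canonical_iff[symmetric] euclidean_product_topology[symmetric] limitin_componentwise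
  by (simp add: tendsto_discrete)

text \<open>The map \<open>g\<close> is an infinite sum of terms chosen so far apart that translates of large compact
  sets \<open>K z\<close> by \<open>g z\<close> are separated from each other even modulo \<open>C - C\<close>.\<close>

lemma separated_compact_translates:
  fixes C :: "'a::{topological_ab_group_add, polish_space} set"
  assumes nlc: "\<not> locally_compact_space (euclidean :: 'a topology)" and C: "compact C"
  obtains g :: "(nat \<Rightarrow> nat) \<Rightarrow> 'a" and K :: "(nat \<Rightarrow> nat) \<Rightarrow> 'a set"
  where "continuous_on UNIV g" "\<And>z. 0 \<in> K z" "closed {p. snd p \<in> K (fst p)}"
    "closed {g z + x | z x. x \<in> K z}"
    "\<And>z z' x x' c c'. x \<in> K z \<Longrightarrow> x' \<in> K z' \<Longrightarrow> c \<in> C \<Longrightarrow> c' \<in> C \<Longrightarrow>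
       g z + x - (g z' + x') = c - c' \<Longrightarrow> z = z'"
    "\<And>K0 a. compact K0 \<Longrightarrow> \<exists>z. (\<forall>n. fst (prod_decode (z n)) = a n) \<and> K0 \<subseteq> K z"
proof -
  \<comment> \<open>With \<open>0\<close> included, \<open>c = c' = 0\<close> is admissible in
    \<open>sep\<close> below, as the closedness of the union of all translates requires.\<close>
  define C' where "C' = insert 0 C"
  have C': "compact C'" "0 \<in> C'" "C \<subseteq> C'" using C by (auto simp: C'_def)
  obtain V :: "nat \<Rightarrow> 'a set" where V: "separating_neighbourhoods V"
    using separating_neighbourhoods_exist[OF nlc] by blast
  have V_closed: "closed (V n)" and V_int: "0 \<in> interior (V n)" and V_sym: "x \<in> V n \<Longrightarrow> - x \<in> V n"
    and V_ball: "V n \<subseteq> ball 0 (1 / real (Suc n))"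
    and V_add: "x \<in> V (Suc n) \<Longrightarrow> y \<in> V (Suc n) \<Longrightarrow> x + y \<in> V n"
    and V_sep: "compact L \<Longrightarrow> \<exists>v\<in>V n. \<forall>l\<in>L. v - l \<notin> V (Suc n)" for n x y L
    using V[unfolded separating_neighbourhoods_def, THEN spec, of n] by simp_all
  have V_0: "0 \<in> V n" for n using V_int interior_subset by blast
  have V_diff: "x - y \<in> V n" if "x \<in> V (Suc n)" "y \<in> V (Suc n)" for x y n
    using V_add[OF that(1) V_sym[OF that(2)]] by simp
  have V_dec: "V m \<subseteq> V n" if "n \<le> m" for n m
  proof -
    have "V (Suc k) \<subseteq> V k" for k using V_add[of _ k 0] V_0 by force
    then show ?thesis using that by (rule lift_Suc_antimono_le)
  qed
  have V_base: "\<exists>n. V n \<subseteq> U" if "open U" "0 \<in> U" for U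
  proof -
    obtain e where e: "e > 0" "ball 0 e \<subseteq> U" using \<open>open U\<close> \<open>0 \<in> U\<close> open_contains_ball by blast
    then obtain k where "1 / real (Suc k) < e" by (metis nat_approx_posE)
    then have "V k \<subseteq> ball 0 e" using V_ball[of k] by force
    with e(2) show ?thesis by blast
  qed
  obtain q0 :: "nat \<Rightarrow> 'a" where q0: "\<And>U. open U \<Longrightarrow> U \<noteq> {} \<Longrightarrow> \<exists>n. q0 n \<in> U"
    using countable_dense_sequence by metis
  \<comment> \<open>Starting with \<open>0\<close> puts \<open>0\<close> into every
    \<open>K z\<close>, however small the bounds in \<open>z\<close> are.\<close>
  define q where "q = case_nat 0 q0"
  have q_dense: "\<exists>n. q n \<in> U" if "open U" "U \<noteq> {}" for U
    using q0[OF that] by (metis q_def nat.case(2))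
  define L where "L i = {c - c' + (q k - q l) | c c' k l. c \<in> C' \<and> c' \<in> C' \<and> k \<le> i \<and> l \<le> i}" for i
  have L_mono: "L i \<subseteq> L j" if "i \<le> j" for i j using that unfolding L_def by fastforce
  have L_sym: "- l \<in> L i" if "l \<in> L i" for l i
  proof -
    from that obtain c c' k m where "c \<in> C'" "c' \<in> C'" "k \<le> i" "m \<le> i" "l = c - c' + (q k - q m)"
      unfolding L_def by blast
    moreover from this have "- l = c' - c + (q m - q k)" by simp
    ultimately show ?thesis unfolding L_def by blast
  qed
  \<comment> \<open>Coordinate \<open>n\<close> owns five levels of \<open>V\<close>. Terms lie in
    level \<open>5 * n + 1\<close>, so that tails of the sum lie in \<open>5 * n\<close>. The tail
    after the term and the errors in \<open>K z\<close> lie in \<open>5 * n + 5\<close>; three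
    additions bring them to \<open>5 * n + 2\<close>, the level by which terms are
    separated.\<close>
  have "\<forall>n. \<exists>\<gamma> :: nat \<Rightarrow> 'a. \<forall>i. \<gamma> i \<in> V (5 * n + 1) \<and> (\<forall>j<i. \<forall>l\<in>L i. \<gamma> i - \<gamma> j - l \<notin> V (Suc (5 * n + 1)))"
    unfolding L_def
    by (intro allI separated_sequence_exists V_sep compact_finite_differences C')
  then obtain \<gamma> :: "nat \<Rightarrow> nat \<Rightarrow> 'a" where *: "\<And>n i. \<gamma> n i \<in> V (5 * n + 1) \<and>
      (\<forall>j<i. \<forall>l\<in>L i. \<gamma> n i - \<gamma> n j - l \<notin> V (Suc (5 * n + 1)))"
    by metis
  have \<gamma>: "\<gamma> n i \<in> V (5 * n + 1)" for n i using * by blast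
  have \<gamma>_lt: "\<gamma> n i - \<gamma> n j - l \<notin> V (5 * n + 2)" if "j < i" "l \<in> L i" for n i j l
    using * that by simp
  have \<gamma>_sep: "\<gamma> n i - \<gamma> n j - l \<notin> V (5 * n + 2)" if "i \<noteq> j" "l \<in> L (max i j)" for n i j l
  proof (cases "j < i")
    case True
    then show ?thesis using that \<gamma>_lt by (simp add: max_absorb1)
  next
    case False
    then have "\<gamma> n j - \<gamma> n i - (- l) \<notin> V (5 * n + 2)"
      using that L_sym \<gamma>_lt[of i j "- l"] by (simp add: max_absorb2)
    moreover have "\<gamma> n j - \<gamma> n i - (- l) = - (\<gamma> n i - \<gamma> n j - l)" by simp
    ultimately show ?thesis using V_sym by metis
  qed

  define S where "S z n = (\<Sum>k<n. \<gamma> k (z k))" for z n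
  have S_tail: "S z m - S z n \<in> V (5 * n)" if "n \<le> m" for z n m
    using that
  proof (induction rule: inc_induct)
    case base
    then show ?case by (simp add: V_0)
  next
    case (step n)
    have "S z m - S z (Suc n) \<in> V (5 * n + 1)" using step V_dec[of "5 * n + 1" "5 * Suc n"] by auto
    then have "\<gamma> n (z n) + (S z m - S z (Suc n)) \<in> V (5 * n)" using V_add \<gamma> by simp
    then show ?case by (simp add: S_def algebra_simps)
  qed
  have "convergent (S z)" for z
  proof (rule group_Cauchy_convergent)
    fix U :: "'a set" assume "open U" "0 \<in> U"
    then obtain n where n: "V n \<subseteq> U" using V_base by blast
    have "S z i - S z j \<in> U" if "i \<ge> Suc n" "j \<ge> Suc n" for i j
    proof -
      have *: "S z i - S z (Suc n) \<in> V (Suc n)" if "i \<ge> Suc n" for i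
        using S_tail[OF that, of z] V_dec[of "Suc n" "5 * Suc n"] by auto
      have "(S z i - S z (Suc n)) - (S z j - S z (Suc n)) \<in> V n"
        by (rule V_diff) (intro * that)+
      then show ?thesis using n by auto
    qed
    then show "\<exists>M. \<forall>m\<ge>M. \<forall>n\<ge>M. S z m - S z n \<in> U" by blast
  qed
  then have "\<forall>z. \<exists>l. S z \<longlonglongrightarrow> l" by (simp add: convergent_def)
  then obtain g where g: "\<And>z. S z \<longlonglongrightarrow> g z" by metis
  have g_tail: "g z - S z n \<in> V (5 * n)" for z n
  proof (rule Lim_in_closed_set[OF V_closed])
    show "\<forall>\<^sub>F m in sequentially. S z m - S z n \<in> V (5 * n)"
      using S_tail by (intro eventually_sequentiallyI[of n]) auto
    show "(\<lambda>m. S z m - S z n) \<longlonglongrightarrow> g z - S z n" by (intro tendsto_intros g)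
  qed simp

  have g_cont: "continuous_on UNIV g"
    unfolding continuous_on_sequentially
  proof safe
    fix z :: "nat \<Rightarrow> nat \<Rightarrow> nat" and w assume "z \<longlonglongrightarrow> w"
    have "\<forall>\<^sub>F k in sequentially. g (z k) - g w \<in> V n" for n
    proof -
      have "\<forall>\<^sub>F k in sequentially. \<forall>j<Suc n. z k j = w j"
        using \<open>z \<longlonglongrightarrow> w\<close>[unfolded baire_tendsto_iff]
        by (simp add: eventually_ball_finite flip: lessThan_iff Ball_def)
      then show ?thesis
      proof eventually_elim
        case (elim k)
        then have "S (z k) (Suc n) = S w (Suc n)" by (simp add: S_def)
        moreover have "(g (z k) - S (z k) (Suc n)) - (g w - S w (Suc n)) \<in> V n"
          using g_tail[of _ "Suc n"] V_dec[of "Suc n" "5 * Suc n"] by (intro V_diff[of "g _ - S _ _"]) auto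
        ultimately show ?case by simp
      qed
    qed
    then show "(g \<circ> z) \<longlonglongrightarrow> g w" unfolding o_def by (intro tendsto_groupI[OF V_base])
  qed

  \<comment> \<open>The number \<open>z n\<close> bounds how many translates of level
    \<open>5 * n + 5\<close> may be used, so \<open>K z\<close> grows with \<open>z\<close>.\<close>
  define K where "K z = {x. \<forall>n. \<exists>i\<le>z n. x - q i \<in> V (5 * n + 5)}" for z
  have K_0: "0 \<in> K z" for z
    by (auto simp: K_def q_def V_0 intro!: exI[of _ 0])
  have K_closed: "closed {p. snd p \<in> K (fst p)}"
  proof -
    have "{p. snd p \<in> K (fst p)} = (\<Inter>n m. (\<lambda>p. fst p n) -` (- {m}) \<union> (\<Union>i\<le>m. (\<lambda>p. snd p - q i) -` V (5 * n + 5)))"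
      by (auto simp: K_def Bex_def) blast
    also have "closed \<dots>"
    proof (intro closed_INT ballI closed_Un closed_UN finite_atMost)
      fix n m i
      show "closed ((\<lambda>p :: (nat \<Rightarrow> nat) \<times> 'a. fst p n) -` (- {m}))"
        by (intro closed_vimage continuous_on_product_then_coordinatewise[OF continuous_on_fst[OF continuous_on_id]])
          (simp add: closed_def Topological_Spaces.open_discrete)
      show "closed ((\<lambda>p :: (nat \<Rightarrow> nat) \<times> 'a. snd p - q i) -` V (5 * n + 5))"
        by (intro closed_vimage V_closed continuous_intros)
    qed
    finally show ?thesis .
  qed
  \<comment> \<open>The version with an error serves twice: with error \<open>0\<close> it separates
    the translates, and with a small error it makes the coordinates of \<open>z\<close> stabilise
    along a convergent sequence of points. Everything is decided at the first coordinate
    \<open>m\<close> where \<open>z\<close> and \<open>z'\<close> differ.\<close>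
  have sep: "z j = z' j"
    if x: "x \<in> K z" "x' \<in> K z'" and c: "c \<in> C'" "c' \<in> C'" and "j \<le> n"
      and u: "g z + x - (g z' + x') - (c - c') \<in> V (5 * n + 5)" for z z' x x' c c' j n
  proof (rule ccontr)
    assume "z j \<noteq> z' j"
    define m where "m = (LEAST j. z j \<noteq> z' j)"
    have m: "z m \<noteq> z' m" unfolding m_def using \<open>z j \<noteq> z' j\<close> by (rule LeastI)
    have "m \<le> n" using Least_le[of "\<lambda>j. z j \<noteq> z' j" j] \<open>z j \<noteq> z' j\<close> \<open>j \<le> n\<close> by (simp add: m_def)
    have "z k = z' k" if "k < m" for k using that not_less_Least unfolding m_def by blast
    then have "S z m = S z' m" by (simp add: S_def)
    obtain i where i: "i \<le> z m" "x - q i \<in> V (5 * m + 5)" using x(1) unfolding K_def by blast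
    obtain i' where i': "i' \<le> z' m" "x' - q i' \<in> V (5 * m + 5)" using x(2) unfolding K_def by blast
    define v where "v = g z + x - (g z' + x') - (c - c')"
    define r where "r = g z - S z (Suc m)"
    define r' where "r' = g z' - S z' (Suc m)"
    define l where "l = c - c' + (q i' - q i)"
    have "r \<in> V (5 * m + 5)" "r' \<in> V (5 * m + 5)"
      using g_tail[of _ "Suc m"] by (simp_all add: r_def r'_def algebra_simps)
    then have "r' - r \<in> V (5 * m + 4)" "x' - q i' - (x - q i) \<in> V (5 * m + 4)"
      using V_diff[of _ "5 * m + 4"] i(2) i'(2) by (simp_all add: add.commute[of 5])
    then have "(x' - q i' - (x - q i)) + (r' - r) \<in> V (5 * m + 3)"
      using V_add[of _ "5 * m + 3"] by (simp add: add.commute[of 4])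
    moreover have "v \<in> V (5 * m + 3)"
      using u V_dec[of "5 * m + 3" "5 * n + 5"] \<open>m \<le> n\<close> by (auto simp: v_def)
    ultimately have "v + ((x' - q i' - (x - q i)) + (r' - r)) \<in> V (5 * m + 2)"
      using V_add[of _ "5 * m + 2"] by (simp add: eval_nat_numeral)
    also have "v + ((x' - q i' - (x - q i)) + (r' - r)) = (S z (Suc m) - S z' (Suc m)) - l"
      by (simp add: v_def r_def r'_def l_def algebra_simps)
    also have "\<dots> = \<gamma> m (z m) - \<gamma> m (z' m) - l"
      using \<open>S z m = S z' m\<close> by (simp add: S_def)
    finally have "\<gamma> m (z m) - \<gamma> m (z' m) - l \<in> V (5 * m + 2)" .
    \<comment> \<open>The number \<open>z m\<close> has two roles: it selects the term of
      \<open>g\<close> and bounds the points \<open>q i\<close> used by \<open>K z\<close> at this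
      level. Hence the later of the two terms was chosen to avoid exactly such differences.\<close>
    moreover have "l \<in> L (max (z m) (z' m))"
      unfolding L_def l_def using c i(1) i'(1) by (fastforce intro: le_max_iff_disj[THEN iffD2])
    ultimately show False using \<gamma>_sep m by blast
  qed
  show thesis
  proof (rule that[OF g_cont K_0 K_closed])
    fix z z' x x' c c'
    assume "x \<in> K z" "x' \<in> K z'" "c \<in> C" "c' \<in> C" "g z + x - (g z' + x') = c - c'"
    then have "z j = z' j" for j using sep[of x z x' z' c c' j j] C'(3) V_0 by auto
    then show "z = z'" by auto
  next
    show "closed {g z + x | z x. x \<in> K z}"
      unfolding closed_sequential_limits
    proof (intro allI impI, elim conjE)
      fix y l assume "\<forall>n. y n \<in> {g z + x | z x. x \<in> K z}" and lim: "y \<longlonglongrightarrow> l"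
      then have "\<forall>n. \<exists>z x. y n = g z + x \<and> x \<in> K z" by blast
      then obtain z x where y: "\<And>n. y n = g (z n) + x n" and x: "\<And>n. x n \<in> K (z n)" by metis
      have "\<exists>M. \<forall>k\<ge>M. z k n = z M n" for n
      proof -
        have "open {u. u - l \<in> interior (V (5 * n + 6))}" "l \<in> {u. u - l \<in> interior (V (5 * n + 6))}"
          using V_int by (auto intro: open_translate)
        then have "\<forall>\<^sub>F k in sequentially. y k \<in> {u. u - l \<in> interior (V (5 * n + 6))}"
          using lim topological_tendstoD by blast
        then obtain M where M: "\<And>k. k \<ge> M \<Longrightarrow> y k - l \<in> V (5 * n + 6)"
          using interior_subset unfolding eventually_sequentially by blast
        have "z k n = z M n" if "k \<ge> M" for k
        proof -
          have "(y k - l) - (y M - l) \<in> V (5 * n + 5)"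
            by (rule V_diff) (use M[OF that] M[of M] in \<open>simp_all add: add.commute[of 6]\<close>)
          then have "g (z k) + x k - (g (z M) + x M) - (0 - 0) \<in> V (5 * n + 5)" by (simp add: y)
          then show ?thesis using sep[OF x x C'(2) C'(2) order_refl] by blast
        qed
        then show ?thesis by blast
      qed
      then obtain M where M: "\<And>n k. k \<ge> M n \<Longrightarrow> z k n = z (M n) n" by metis
      define w where "w n = z (M n) n" for n
      have zw: "z \<longlonglongrightarrow> w"
        unfolding baire_tendsto_iff eventually_sequentially w_def using M by blast
      then have "(\<lambda>k. g (z k)) \<longlonglongrightarrow> g w"
        using g_cont by (simp add: continuous_on_tendsto_compose)
      then have "(\<lambda>k. y k - g (z k)) \<longlonglongrightarrow> l - g w" using lim by (intro tendsto_intros)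
      then have "x \<longlonglongrightarrow> l - g w" by (simp add: y)
      from closed_sequentially[OF K_closed _ tendsto_Pair[OF zw this]] x
      have "l - g w \<in> K w" by simp
      then show "l \<in> {g z + x | z x. x \<in> K z}" by (auto intro!: exI[of _ w] exI[of _ "l - g w"])
    qed
  next
    fix K0 :: "'a set" and a :: "nat \<Rightarrow> nat" assume K0: "compact K0"
    have "\<exists>b. \<forall>x\<in>K0. \<exists>i\<le>b. x - q i \<in> V (5 * n + 5)" for n
    proof -
      let ?U = "\<lambda>i. {x. x - q i \<in> interior (V (5 * n + 5))}"
      have "K0 \<subseteq> (\<Union>i\<in>UNIV. ?U i)"
      proof
        fix x
        have "open {y. x - y \<in> interior (V (5 * n + 5))}" by (intro open_translate open_interior)
        moreover have "x \<in> {y. x - y \<in> interior (V (5 * n + 5))}" using V_int by simp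
        ultimately show "x \<in> (\<Union>i\<in>UNIV. ?U i)" using q_dense by blast
      qed
      then obtain I where I: "finite I" "K0 \<subseteq> (\<Union>i\<in>I. ?U i)"
        using compactE_image[OF K0, of UNIV ?U] open_translate(2)[OF open_interior] by metis
      then have "\<forall>x\<in>K0. \<exists>i\<le>Max I. x - q i \<in> V (5 * n + 5)"
        using interior_subset[of "V (5 * n + 5)"] Max_ge[OF I(1)] by blast
      then show ?thesis by blast
    qed
    then obtain b where b: "\<And>n x. x \<in> K0 \<Longrightarrow> \<exists>i\<le>b n. x - q i \<in> V (5 * n + 5)" by metis
    \<comment> \<open>The pairing makes \<open>z n\<close> at least \<open>b n\<close>, so the bound
      is met while the first component carries \<open>a n\<close>.\<close>
    define z where "z n = prod_encode (a n, b n)" for n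
    have "b n \<le> z n" for n by (simp add: z_def le_prod_encode_2)
    then have "K0 \<subseteq> K z" unfolding K_def using b order_trans by blast
    then show "\<exists>z. (\<forall>n. fst (prod_decode (z n)) = a n) \<and> K0 \<subseteq> K z"
      by (intro exI[of _ z]) (simp add: z_def)
  qed
qed

section \<open>An atomless measure and lexicographically least points\<close>

text \<open>Separation with respect to the compact set \<open>{0}\<close> makes \<open>g\<close> a
  continuous injection of Baire space. Lebesgue measure on the unit interval, moved into the binary
  sequences by a Borel injection and then by \<open>g\<close>, lives on a compact set and has no
  atoms.\<close>

lemma compact_atomless_measure_exists:
  assumes nlc: "\<not> locally_compact_space (euclidean :: 'a::{topological_ab_group_add, polish_space} topology)"
  obtains \<mu> :: "'a::{topological_ab_group_add, polish_space} measure" and C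
  where "borel_probability \<mu>" "compact C" "emeasure \<mu> (- C) = 0" "\<And>x. emeasure \<mu> {x} = 0"
proof -
  have compact_sing: "compact {0 :: 'a}" by simp
  obtain g :: "(nat \<Rightarrow> nat) \<Rightarrow> 'a" and K :: "(nat \<Rightarrow> nat) \<Rightarrow> 'a set"
    where g: "continuous_on UNIV g" and K: "\<And>z. 0 \<in> K z"
    and "closed {p. snd p \<in> K (fst p)}" "closed {g z + x | z x. x \<in> K z}"
    and sep: "\<And>z z' x x' c c'. x \<in> K z \<Longrightarrow> x' \<in> K z' \<Longrightarrow> c \<in> {0} \<Longrightarrow> c' \<in> {0} \<Longrightarrow>
       g z + x - (g z' + x') = c - c' \<Longrightarrow> z = z'"
    and "\<And>K0 a. compact K0 \<Longrightarrow> \<exists>z. (\<forall>n. fst (prod_decode (z n)) = a n) \<and> K0 \<subseteq> K z"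
    by (rule separated_compact_translates[OF nlc compact_sing]) (rule that)
  have "inj g"
  proof (rule injI)
    fix z z' assume "g z = g z'"
    then show "z = z'" using sep[OF K K, of 0 0 z z'] by simp
  qed
  have [measurable]: "g \<in> borel_measurable borel" by (rule borel_measurable_continuous_onI[OF g])
  obtain q :: "nat \<Rightarrow> real" where q: "\<And>U. open U \<Longrightarrow> U \<noteq> {} \<Longrightarrow> \<exists>n. q n \<in> U"
    using countable_dense_sequence by metis
  \<comment> \<open>A real number is coded by the cut it makes in a dense sequence.\<close>
  define b :: "real \<Rightarrow> nat \<Rightarrow> nat" where "b x i = (if x < q i then 1 else 0)" for x i
  have [measurable]: "b \<in> borel_measurable borel"
    unfolding b_def by (intro measurable_coordinatewise_then_product) measurable
  have b_less: "b x \<noteq> b y" if "x < y" for x y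
  proof -
    have "{x<..<y} \<noteq> {}" using that by simp
    then obtain n where "q n \<in> {x<..<y}" using q[OF open_greaterThanLessThan] by blast
    then have "b x n \<noteq> b y n" by (auto simp: b_def)
    then show ?thesis by auto
  qed
  have "inj b"
  proof (rule injI)
    fix x y assume "b x = b y"
    then show "x = y" using b_less[of x y] b_less[of y x] by (cases x y rule: linorder_cases) auto
  qed
  define M where "M = uniform_measure lborel {0..1::real}"
  define \<mu> where "\<mu> = distr M borel (g \<circ> b)"
  have setsM [measurable_cong]: "sets M = sets borel" by (simp add: M_def)
  have "prob_space M" unfolding M_def by (rule prob_space_uniform_measure) auto
  then have "borel_probability \<mu>"
    unfolding \<mu>_def borel_probability_def by (auto intro!: prob_space.prob_space_distr)
  define C where "C = g ` {z. \<forall>n. z n \<le> 1}"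
  have "compact {z :: nat \<Rightarrow> nat. \<forall>n. z n \<le> 1}"
  proof -
    have "compactin (product_topology (\<lambda>_. euclidean) UNIV) (PiE UNIV (\<lambda>_ :: nat. {..1 :: nat}))"
      unfolding compactin_PiE by (simp add: finite_imp_compact)
    moreover have "PiE UNIV (\<lambda>_ :: nat. {..1 :: nat}) = {z. \<forall>n. z n \<le> 1}" by auto
    ultimately show ?thesis by (simp add: euclidean_product_topology)
  qed
  then have "compact C"
    unfolding C_def by (intro compact_continuous_image continuous_on_subset[OF g]) auto
  have "emeasure \<mu> (- C) = 0"
  proof -
    have "- C \<in> sets borel" using \<open>compact C\<close> by (simp add: compact_imp_closed borel_open open_Compl)
    moreover have "(g \<circ> b) -` (- C) = {}" by (auto simp: C_def b_def)
    ultimately show ?thesis unfolding \<mu>_def by (subst emeasure_distr) auto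
  qed
  have "emeasure \<mu> {x} = 0" for x
  proof -
    have "inj (g \<circ> b)" using \<open>inj g\<close> \<open>inj b\<close> by (rule inj_compose)
    from inj_vimage_singleton[OF this] obtain r where r: "(g \<circ> b) -` {x} \<subseteq> {r}" ..
    have "emeasure \<mu> {x} = emeasure M ((g \<circ> b) -` {x})"
      unfolding \<mu>_def by (subst emeasure_distr) (auto simp: sets_eq_imp_space_eq[OF setsM])
    also have "\<dots> \<le> emeasure M {r}" by (intro emeasure_mono r) (simp add: setsM)
    also have "\<dots> = 0"
    proof -
      have "emeasure lborel ({0..1} \<inter> {r}) \<le> emeasure lborel {r}" by (intro emeasure_mono) auto
      then show ?thesis unfolding M_def by (subst emeasure_uniform_measure) auto
    qed
    finally show ?thesis by simp
  qed
  then show thesis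
    by (rule that[OF \<open>borel_probability \<mu>\<close> \<open>compact C\<close> \<open>emeasure \<mu> (- C) = 0\<close>])
qed

lemma measurable_nat_coordinate:
  fixes f :: "'a \<Rightarrow> 'i \<Rightarrow> nat"
  assumes "f \<in> borel_measurable M"
  shows "(\<lambda>x. f x i) \<in> M \<rightarrow>\<^sub>M count_space UNIV"
  using measurable_product_then_coordinatewise[OF assms, of i]
  by (simp add: measurable_cong_sets[OF refl sets_borel_eq_count_space])

lemma measurable_coordinatewise_nat:
  fixes f :: "'a \<Rightarrow> 'i::countable \<Rightarrow> nat"
  assumes "\<And>i. (\<lambda>x. f x i) \<in> M \<rightarrow>\<^sub>M count_space UNIV"
  shows "f \<in> borel_measurable M"
  using assms
  by (intro measurable_coordinatewise_then_product)
    (simp add: measurable_cong_sets[OF refl sets_borel_eq_count_space])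

text \<open>Codes and lexicographic order need Baire space, while the Borel set and its measure live
  on the group; this pair of maps transfers between them. \<open>\<tau> x\<close> lists dense points
  approaching \<open>x\<close>, and \<open>\<kappa>\<close> takes the limit.\<close>

lemma borel_retraction_of_baire_space:
  obtains \<tau> :: "'a::polish_space \<Rightarrow> nat \<Rightarrow> nat" and \<kappa> :: "(nat \<Rightarrow> nat) \<Rightarrow> 'a"
  where "\<tau> \<in> borel_measurable borel" "\<kappa> \<in> borel_measurable borel" "\<And>x. \<kappa> (\<tau> x) = x"
proof -
  obtain q :: "nat \<Rightarrow> 'a" where q: "\<And>U. open U \<Longrightarrow> U \<noteq> {} \<Longrightarrow> \<exists>n. q n \<in> U"
    using countable_dense_sequence by metis
  define \<tau> where "\<tau> x n = (LEAST i. dist x (q i) < 1 / real (Suc n))" for x n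
  have \<tau>: "dist x (q (\<tau> x n)) < 1 / real (Suc n)" for x n
  proof -
    have "ball x (1 / real (Suc n)) \<noteq> {}" by (simp add: not_le)
    then obtain i where "dist x (q i) < 1 / real (Suc n)" using q[OF open_ball] by fastforce
    then show ?thesis unfolding \<tau>_def by (rule LeastI)
  qed
  then have lim: "(\<lambda>n. q (\<tau> x n)) \<longlonglongrightarrow> x" for x
  proof (intro metric_tendsto_imp_tendsto[OF LIMSEQ_inverse_real_of_nat] always_eventually allI)
    fix n show "dist (q (\<tau> x n)) x \<le> dist (inverse (real (Suc n))) 0"
      using \<tau>[of x n] by (simp add: dist_commute inverse_eq_divide less_imp_le)
  qed
  have "\<tau> \<in> borel_measurable borel"
    unfolding \<tau>_def by (intro measurable_coordinatewise_nat measurable_Least) measurable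
  \<comment> \<open>The constant default off the Cauchy sequences makes the limit exist everywhere,
    so \<open>\<kappa>\<close> is a pointwise limit of Borel maps.\<close>
  define F where "F n t = (if Cauchy (\<lambda>n. q (t n)) then q (t n) else q 0)" for n and t :: "nat \<Rightarrow> nat"
  define \<kappa> where "\<kappa> t = lim (\<lambda>n. F n t)" for t
  have conv: "(\<lambda>n. F n t) \<longlonglongrightarrow> \<kappa> t" for t
  proof (cases "Cauchy (\<lambda>n. q (t n))")
    case True
    then show ?thesis
      by (simp add: F_def \<kappa>_def Cauchy_convergent_iff convergent_LIMSEQ_iff)
  qed (simp add: F_def \<kappa>_def)
  have "(\<lambda>t. q (t n)) \<in> borel_measurable borel" for n :: nat
    using measurable_compose[OF measurable_nat_coordinate[of "\<lambda>t. t" borel n], of q borel] by simp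
  then have "F n \<in> borel_measurable borel" for n
    unfolding F_def by measurable
  then have "\<kappa> \<in> borel_measurable borel"
    by (rule borel_measurable_LIMSEQ_metric) (rule conv)
  have retract: "\<kappa> (\<tau> x) = x" for x
  proof -
    have "Cauchy (\<lambda>n. q (\<tau> x n))" using lim LIMSEQ_imp_Cauchy by blast
    then have "(\<lambda>n. q (\<tau> x n)) \<longlonglongrightarrow> \<kappa> (\<tau> x)" using conv[of "\<tau> x"] by (simp add: F_def)
    then show ?thesis using lim LIMSEQ_unique by blast
  qed
  show thesis by (rule that) fact+
qed

definition lex_less :: "(nat \<Rightarrow> nat) \<Rightarrow> (nat \<Rightarrow> nat) \<Rightarrow> bool" where
  "lex_less s t \<longleftrightarrow> (\<exists>n. (\<forall>i<n. s i = t i) \<and> s n < t n)"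

lemma lex_less_linear:
  assumes "s \<noteq> t"
  shows "lex_less s t \<or> lex_less t s"
proof -
  define n where "n = (LEAST n. s n \<noteq> t n)"
  have "\<exists>n. s n \<noteq> t n" using assms by auto
  then have "s n \<noteq> t n" unfolding n_def by (rule LeastI_ex)
  moreover have eq: "s i = t i" if "i < n" for i using not_less_Least[OF that[unfolded n_def]] by simp
  ultimately consider "s n < t n" | "t n < s n" by linarith
  then show ?thesis
  proof cases
    case 1
    with eq have "lex_less s t" unfolding lex_less_def by blast
    then show ?thesis ..
  next
    case 2
    with eq[symmetric] have "lex_less t s" unfolding lex_less_def by blast
    then show ?thesis ..
  qed
qed

text \<open>Minimise the coordinates one after another. The sets stay nonempty, and points chosen
  from them converge to the only candidate, which lies in \<open>L\<close> because \<open>L\<close>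
  is closed.\<close>

lemma closed_lex_least_exists:
  fixes L :: "(nat \<Rightarrow> nat) set"
  assumes "closed L" "L \<noteq> {}"
  shows "\<exists>t\<in>L. \<forall>s\<in>L. \<not> lex_less s t"
proof -
  define A where "A = rec_nat L (\<lambda>n B. {t\<in>B. \<forall>s\<in>B. t n \<le> s n})"
  have A0: "A 0 = L" and AS: "A (Suc n) = {t\<in>A n. \<forall>s\<in>A n. t n \<le> s n}" for n
    by (simp_all add: A_def)
  have "A n \<noteq> {}" for n
  proof (induction n)
    case (Suc n)
    then obtain t where "t \<in> A n" "\<forall>s\<in>A n. t n \<le> s n"
      using ex_has_least_nat[of "\<lambda>t. t \<in> A n" _ "\<lambda>t. t n"] by blast
    then show ?case by (auto simp: AS)
  qed (simp add: A0 assms)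
  then have "\<forall>n. \<exists>t. t \<in> A n" by blast
  then obtain t where t: "\<And>n. t n \<in> A n" by metis
  have dec: "A m \<subseteq> A n" if "n \<le> m" for n m
    by (rule lift_Suc_antimono_le[OF _ that]) (simp add: AS)
  define w where "w n = t (Suc n) n" for n
  have w: "s i = w i" if "s \<in> A n" "i < n" for s i n
  proof -
    have "s \<in> A (Suc i)" using dec[of "Suc i" n] that by auto
    then show ?thesis using t[of "Suc i"] unfolding w_def AS by (auto intro: antisym)
  qed
  have lim: "t \<longlonglongrightarrow> w"
    unfolding baire_tendsto_iff
  proof
    fix i show "\<forall>\<^sub>F k in sequentially. t k i = w i"
    proof (rule eventually_sequentiallyI)
      fix k assume "Suc i \<le> k"
      then show "t k i = w i" using w[OF t, of i k] by simp
    qed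
  qed
  have "t n \<in> L" for n using t[of n] dec[of 0 n] A0 by auto
  with closed_sequentially[OF \<open>closed L\<close> _ lim] have "w \<in> L" by simp
  moreover have "\<not> lex_less s w" if "s \<in> L" for s
  proof
    assume "lex_less s w"
    then obtain n where n: "\<And>i. i < n \<Longrightarrow> s i = w i" "s n < w n" unfolding lex_less_def by blast
    have "m \<le> n \<Longrightarrow> s \<in> A m" for m
    proof (induction m)
      case (Suc m)
      have "s m = t (Suc m) m" using n(1)[of m] Suc.prems by (simp add: w_def)
      moreover have "\<forall>r\<in>A m. t (Suc m) m \<le> r m" using t[of "Suc m"] unfolding AS by simp
      ultimately show ?case using Suc unfolding AS by simp
    qed (simp add: A0 \<open>s \<in> L\<close>)
    then have "w n \<le> s n" using t[of "Suc n"] unfolding w_def AS by simp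
    with n(2) show False by simp
  qed
  ultimately show ?thesis by blast
qed

section \<open>Borel codes\<close>

definition atom_set :: "nat \<Rightarrow> ((nat \<Rightarrow> nat) \<times> (nat \<Rightarrow> nat)) set" where
  "atom_set k = (case prod_decode k of (b, m) \<Rightarrow> case prod_decode m of (i, j) \<Rightarrow>
     {p. (if b = 0 then fst p i else snd p i) = j})"

inductive code_wf :: "(nat list \<Rightarrow> nat) \<Rightarrow> nat list \<Rightarrow> bool" for lab where
  leaf: "lab s \<noteq> 0 \<Longrightarrow> code_wf lab s"
| node: "(\<And>n. code_wf lab (s @ [n])) \<Longrightarrow> code_wf lab s"

text \<open>A single operation suffices: a constant family gives complements, and complementing the
  members first gives unions.\<close>

definition code_sets :: "(nat list \<Rightarrow> nat) \<Rightarrow> (nat list \<Rightarrow> ((nat \<Rightarrow> nat) \<times> (nat \<Rightarrow> nat)) set) \<Rightarrow> bool" where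
  "code_sets lab S \<longleftrightarrow> (\<forall>s. S s = (if lab s = 0 then \<Union>n. - S (s @ [n]) else atom_set (lab s - 1)))"

lemma code_wf_not_on_path:
  assumes "code_wf lab s" "\<And>n. n \<ge> m \<Longrightarrow> lab (map p [0..<n]) = 0" "n \<ge> m"
  shows "s \<noteq> map p [0..<n]"
  using assms(1,3)
proof (induction arbitrary: n)
  case (leaf s)
  then show ?case using assms(2) by auto
next
  case (node s)
  show ?case
  proof
    assume "s = map p [0..<n]"
    then have "s @ [p n] = map p [0..<Suc n]" by simp
    then show False using node.IH[of "Suc n" "p n"] node.prems by simp
  qed
qed

lemma not_code_wf_path_exists:
  assumes "\<not> code_wf lab s"
  shows "\<exists>p m. \<forall>n\<ge>m. lab (map p [0..<n]) = 0"
proof -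
  define f where "f r = (SOME n. \<not> code_wf lab (r @ [n]))" for r
  define sq where "sq k = ((\<lambda>r. r @ [f r]) ^^ k) s" for k
  have sq0: "sq 0 = s" and sqS: "sq (Suc k) = sq k @ [f (sq k)]" for k
    by (simp_all add: sq_def)
  have nwf: "\<not> code_wf lab (sq k)" for k
  proof (induction k)
    case (Suc k)
    then have "\<exists>n. \<not> code_wf lab (sq k @ [n])" using code_wf.node by blast
    then show ?case unfolding sqS f_def by (rule someI_ex)
  qed (simp add: sq0 assms)
  have len: "length (sq k) = length s + k" for k
    by (induction k) (simp_all add: sq0 sqS)
  have nth: "sq (k + d) ! i = sq k ! i" if "i < length (sq k)" for k d i
  proof (induction d)
    case (Suc d)
    then show ?case using that by (simp add: sqS nth_append len)
  qed simp
  define p where "p i = sq (Suc i) ! i" for i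
  have "map p [0..<n] = sq (n - length s)" if "n \<ge> length s" for n
  proof (rule nth_equalityI)
    show "length (map p [0..<n]) = length (sq (n - length s))" using that by (simp add: len)
    fix i assume "i < length (map p [0..<n])"
    then have i: "i < n" by simp
    let ?k = "n - length s"
    have "sq (Suc i + ?k) ! i = sq (Suc i) ! i" by (rule nth) (simp add: len)
    moreover have "sq (?k + Suc i) ! i = sq ?k ! i" by (rule nth) (use i that in \<open>simp add: len\<close>)
    ultimately show "map p [0..<n] ! i = sq ?k ! i" using i by (simp add: p_def add.commute)
  qed
  moreover have "lab (sq k) = 0" for k using nwf[of k] code_wf.leaf by blast
  ultimately have "\<forall>n\<ge>length s. lab (map p [0..<n]) = 0" by simp
  then show ?thesis by blast
qed

text \<open>Ill-foundedness becomes the existence of a path, which a projection can express. The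
  threshold \<open>m\<close> is there because well-foundedness is asked of all nodes, even below a
  leaf, so a bad path may start at any depth.\<close>

lemma all_code_wf_iff:
  "(\<forall>s. code_wf lab s) \<longleftrightarrow> \<not> (\<exists>p m. \<forall>n\<ge>m. lab (map p [0..<n]) = 0)"
proof
  assume wf: "\<forall>s. code_wf lab s"
  show "\<not> (\<exists>p m. \<forall>n\<ge>m. lab (map p [0..<n]) = 0)"
  proof
    assume "\<exists>p m. \<forall>n\<ge>m. lab (map p [0..<n]) = 0"
    then obtain p m where "\<And>n. n \<ge> m \<Longrightarrow> lab (map p [0..<n]) = 0" by blast
    then show False using code_wf_not_on_path[of lab "map p [0..<m]" m p m] wf by simp
  qed
next
  assume "\<not> (\<exists>p m. \<forall>n\<ge>m. lab (map p [0..<n]) = 0)"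
  then show "\<forall>s. code_wf lab s" using not_code_wf_path_exists[of lab] by blast
qed

text \<open>The given trees are hung below a new root with label \<open>0\<close>.\<close>

lemma code_exists_UN_Compl:
  assumes "\<And>n :: nat. \<exists>lab S. (\<forall>s. code_wf lab s) \<and> code_sets lab S \<and> S [] = D n"
  shows "\<exists>lab S. (\<forall>s. code_wf lab s) \<and> code_sets lab S \<and> S [] = (\<Union>n. - D n)"
proof -
  have "\<forall>n. \<exists>lab S. (\<forall>s. code_wf lab s) \<and> code_sets lab S \<and> S [] = D n" using assms by simp
  then obtain labs where "\<forall>n. \<exists>S. (\<forall>s. code_wf (labs n) s) \<and> code_sets (labs n) S \<and> S [] = D n"
    by (rule choice[THEN exE])
  then obtain Ss where *: "\<forall>n. (\<forall>s. code_wf (labs n) s) \<and> code_sets (labs n) (Ss n) \<and> Ss n [] = D n"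
    by (rule choice[THEN exE])
  define lab where "lab s = (case s of [] \<Rightarrow> 0 | n # r \<Rightarrow> labs n r)" for s
  define S where "S s = (case s of [] \<Rightarrow> \<Union>n. - D n | n # r \<Rightarrow> Ss n r)" for s
  have "code_wf lab (n # r)" for n r
  proof -
    have "code_wf (labs n) r" using * by simp
    then show ?thesis
    proof induction
      case (leaf r)
      then show ?case by (intro code_wf.leaf) (simp add: lab_def)
    next
      case (node r)
      show ?case by (rule code_wf.node) (use node.IH in simp)
    qed
  qed
  note wf_Cons = this
  have "code_wf lab []" by (rule code_wf.node) (simp add: wf_Cons)
  with wf_Cons have "code_wf lab s" for s by (cases s) simp_all
  moreover have "code_sets lab S"
    unfolding code_sets_def
  proof
    fix s show "S s = (if lab s = 0 then \<Union>n. - S (s @ [n]) else atom_set (lab s - 1))"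
    proof (cases s)
      case Nil
      have "Ss n [] = D n" for n using * by simp
      then show ?thesis by (simp add: Nil S_def lab_def)
    next
      case (Cons n r)
      have "code_sets (labs n) (Ss n)" using * by simp
      then have "Ss n r = (if labs n r = 0 then \<Union>k. - Ss n (r @ [k]) else atom_set (labs n r - 1))"
        unfolding code_sets_def by (rule spec)
      then show ?thesis by (simp add: Cons S_def lab_def)
    qed
  qed
  moreover have "S [] = (\<Union>n. - D n)" by (simp add: S_def)
  ultimately show ?thesis by blast
qed

text \<open>The atoms make all coordinates measurable, so the identity is measurable into the
  product of the Borel algebras, which is the Borel algebra of the product.\<close>

lemma borel_pair_baire_generated_by_atoms:
  assumes "D \<in> sets (borel :: ((nat \<Rightarrow> nat) \<times> (nat \<Rightarrow> nat)) measure)"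
  shows "D \<in> sigma_sets UNIV (range atom_set)"
proof -
  define M where "M = sigma (UNIV :: ((nat \<Rightarrow> nat) \<times> (nat \<Rightarrow> nat)) set) (range atom_set)"
  have sp: "space M = UNIV" and se: "sets M = sigma_sets UNIV (range atom_set)"
    by (simp_all add: M_def)
  have at: "atom_set k \<in> sets M" for k by (simp add: se sigma_sets.Basic)
  have "(\<lambda>p. fst p i) \<in> M \<rightarrow>\<^sub>M count_space UNIV" for i
  proof (subst measurable_count_space_eq2_countable, simp, safe)
    fix j
    have "(\<lambda>p. fst p i) -` {j} \<inter> space M = atom_set (prod_encode (0, prod_encode (i, j)))"
      by (auto simp: atom_set_def sp)
    then show "(\<lambda>p. fst p i) -` {j} \<inter> space M \<in> sets M" using at by simp
  qed
  moreover have "(\<lambda>p. snd p i) \<in> M \<rightarrow>\<^sub>M count_space UNIV" for i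
  proof (subst measurable_count_space_eq2_countable, simp, safe)
    fix j
    have "(\<lambda>p. snd p i) -` {j} \<inter> space M = atom_set (prod_encode (1, prod_encode (i, j)))"
      by (auto simp: atom_set_def sp)
    then show "(\<lambda>p. snd p i) -` {j} \<inter> space M \<in> sets M" using at by simp
  qed
  ultimately have "(\<lambda>p. (fst p, snd p)) \<in> M \<rightarrow>\<^sub>M borel \<Otimes>\<^sub>M borel"
    by (intro measurable_Pair measurable_coordinatewise_nat)
  then have "(\<lambda>p. p) \<in> M \<rightarrow>\<^sub>M borel" by (simp add: borel_prod)
  from measurable_sets[OF this assms] show ?thesis by (simp add: sp se)
qed

lemma borel_code_exists:
  assumes "D \<in> sets (borel :: ((nat \<Rightarrow> nat) \<times> (nat \<Rightarrow> nat)) measure)"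
  shows "\<exists>lab S. (\<forall>s. code_wf lab s) \<and> code_sets lab S \<and> S [] = D"
  using borel_pair_baire_generated_by_atoms[OF assms]
proof induction
  case (Basic a)
  then obtain k where "a = atom_set k" by blast
  then show ?case
    by (intro exI[of _ "\<lambda>_. Suc k"] exI[of _ "\<lambda>_. atom_set k"])
      (auto simp: code_sets_def intro: code_wf.leaf)
next
  case Empty
  have "\<exists>lab S. (\<forall>s. code_wf lab s) \<and> code_sets lab S \<and> S [] = atom_set k" for k
    by (intro exI[of _ "\<lambda>_. Suc k"] exI[of _ "\<lambda>_. atom_set k"])
      (auto simp: code_sets_def intro: code_wf.leaf)
  \<comment> \<open>Two applications, the outer one to a constant family, give an intersection; the
    atoms \<open>fst p 0 = k\<close> have no common point.\<close>
  from code_exists_UN_Compl[OF code_exists_UN_Compl[OF this, of "\<lambda>k. prod_encode (0, prod_encode (0, k))"]]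
  obtain lab S where "\<forall>s. code_wf lab s" "code_sets lab S"
    "S [] = (\<Inter>k. atom_set (prod_encode (0, prod_encode (0, k))))"
    by auto
  moreover have "(\<Inter>k. atom_set (prod_encode (0, prod_encode (0, k)))) = {}"
  proof -
    have "p \<notin> atom_set (prod_encode (0, prod_encode (0, Suc (fst p 0))))" for p
      by (simp add: atom_set_def)
    then show ?thesis by blast
  qed
  ultimately show ?case by metis
next
  case (Compl a)
  from code_exists_UN_Compl[OF Compl.IH] show ?case by (simp add: Compl_eq_Diff_UNIV[symmetric])
next
  case (Union a)
  have "\<exists>lab S. (\<forall>s. code_wf lab s) \<and> code_sets lab S \<and> S [] = - a i" for i
    using code_exists_UN_Compl[of "\<lambda>_. a i", OF Union.IH] by simp
  from code_exists_UN_Compl[OF this] show ?case by simp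
qed

section \<open>Evaluating a code up to a set of small measure\<close>

text \<open>\<open>Nand\<close> of a finite list is the truncation of the union of complements at an
  inner node. In particular \<open>Nand []\<close> is false and \<open>Nand [Nand []]\<close> is
  true.\<close>

datatype form = Atom nat nat | Nand "form list"

instance form :: countable
  by countable_datatype

fun sat :: "(nat \<Rightarrow> nat) \<Rightarrow> form \<Rightarrow> bool" where
  "sat t (Atom i j) \<longleftrightarrow> t i = j"
| "sat t (Nand fs) \<longleftrightarrow> (\<exists>f\<in>set fs. \<not> sat t f)"

lemma clopen_sat: "open {t. sat t f} \<and> closed {t. sat t f}"
proof (induction f)
  case (Atom i j)
  have c: "continuous_on UNIV (\<lambda>t :: nat \<Rightarrow> nat. t i)" by simp
  have "open ((\<lambda>t :: nat \<Rightarrow> nat. t i) -` {j})" "closed ((\<lambda>t :: nat \<Rightarrow> nat. t i) -` {j})"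
    by (rule open_vimage[OF _ c] closed_vimage[OF _ c];
        simp add: Topological_Spaces.open_discrete)+
  then show ?case by (simp add: vimage_def)
next
  case (Nand fs)
  have eq: "{t. sat t (Nand fs)} = (\<Union>f\<in>set fs. - {t. sat t f})" by auto
  show ?case unfolding eq using Nand by (intro conjI open_UN closed_UN ballI open_Compl closed_Compl) auto
qed

text \<open>The second component of \<open>z n\<close> carries no information: it is used to make \<open>z n\<close>, and with it
  \<open>K z\<close>, large.\<close>

definition node_label :: "(nat \<Rightarrow> nat) \<Rightarrow> nat list \<Rightarrow> nat" where
  "node_label z s = fst (prod_decode (fst (prod_decode (z (to_nat s)))))"

definition large_bit :: "(nat \<Rightarrow> nat) \<Rightarrow> nat \<Rightarrow> nat" where
  "large_bit z m = snd (prod_decode (fst (prod_decode (z m))))"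

text \<open>An atom about \<open>z\<close> is replaced by its truth value, so that the formulas speak about \<open>t\<close> only;
  otherwise the bits of \<open>z\<close> describing measures of formulas would depend on \<open>z\<close> itself.\<close>

definition leaf_form :: "(nat \<Rightarrow> nat) \<Rightarrow> nat \<Rightarrow> form" where
  "leaf_form z k = (case prod_decode k of (b, m) \<Rightarrow> case prod_decode m of (i, j) \<Rightarrow>
     if b = 0 then (if z i = j then Nand [Nand []] else Nand []) else Atom i j)"

lemma sat_leaf_form: "sat t (leaf_form z k) \<longleftrightarrow> (z, t) \<in> atom_set k"
  by (auto simp: leaf_form_def atom_set_def split: prod.splits)

text \<open>The bit of \<open>z\<close> at \<open>(s, N, l)\<close> is intended to vanish iff the set of points at which some formula
  in \<open>l\<close> fails but the first \<open>N\<close> hold has measure at most \<open>(1/2) ^ Suc (Suc (to_nat s))\<close>.\<close>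

definition good_cut :: "(nat \<Rightarrow> nat) \<Rightarrow> (nat list \<Rightarrow> nat) \<Rightarrow> nat list \<Rightarrow> nat \<Rightarrow> bool" where
  "good_cut z e s N \<longleftrightarrow> (\<forall>M. large_bit z (to_nat (s, N, map (\<lambda>n. e (s @ [n])) [0..<M])) = 0)"

text \<open>If no cut is good, \<open>LEAST\<close> still denotes some fixed number, so a
  well-founded code has exactly one evaluation even when the bits of \<open>z\<close> are
  meaningless. Formulas are stored as numbers to let \<open>e\<close> range over a Polish
  space.\<close>

definition eval_step :: "(nat \<Rightarrow> nat) \<Rightarrow> (nat list \<Rightarrow> nat) \<Rightarrow> nat list \<Rightarrow> nat" where
  "eval_step z e s = (if node_label z s = 0
     then to_nat (Nand (map (\<lambda>n. from_nat (e (s @ [n]))) [0..<(LEAST N. good_cut z e s N)]))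
     else to_nat (leaf_form z (node_label z s - 1)))"

text \<open>\<open>e\<close> assigns to every node of the code \<open>z\<close> a finite formula approximating, up to a small
  error in measure, the section at \<open>z\<close> of the Borel set coded at that node.\<close>

definition evaluation :: "(nat \<Rightarrow> nat) \<Rightarrow> (nat list \<Rightarrow> nat) \<Rightarrow> bool" where
  "evaluation z e \<longleftrightarrow> (\<forall>s. e s = eval_step z e s)"

lemma eval_step_cong:
  assumes "node_label z s = 0 \<Longrightarrow> (\<And>n. e (s @ [n]) = e' (s @ [n]))"
  shows "eval_step z e s = eval_step z e' s"
proof (cases "node_label z s = 0")
  case True
  note eq = assms[OF this]
  have "good_cut z e s = good_cut z e' s" by (intro ext) (simp add: good_cut_def eq)
  then show ?thesis by (simp add: eval_step_def eq)
qed (simp add: eval_step_def)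

lemma evaluation_unique:
  assumes wf: "\<And>s. code_wf (node_label z) s" and "evaluation z e" "evaluation z e'"
  shows "e = e'"
proof
  fix s
  from wf[of s] show "e s = e' s"
  proof induction
    case (leaf s)
    then have "eval_step z e s = eval_step z e' s" by (intro eval_step_cong) simp
    then show ?case using assms(2,3) unfolding evaluation_def by metis
  next
    case (node s)
    then have "eval_step z e s = eval_step z e' s" by (intro eval_step_cong)
    then show ?case using assms(2,3) unfolding evaluation_def by metis
  qed
qed

lemma evaluation_exists:
  assumes wf: "\<And>s. code_wf (node_label z) s"
  shows "\<exists>e. evaluation z e"
proof -
  define r where "r = {(s @ [n], s) | s n. node_label z s = 0}"
  have "wf r"
  proof (rule wfUNIVI)
    fix P s assume step: "\<forall>x. (\<forall>y. (y, x) \<in> r \<longrightarrow> P y) \<longrightarrow> P x"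
    from wf[of s] show "P s"
    proof induction
      case (leaf s)
      then have "\<forall>y. (y, s) \<in> r \<longrightarrow> P y" by (auto simp: r_def)
      then show ?case using step by blast
    next
      case (node s)
      from node.IH have "\<forall>y. (y, s) \<in> r \<longrightarrow> P y" by (auto simp: r_def)
      then show ?case using step by blast
    qed
  qed
  define e where "e = wfrec r (eval_step z)"
  have "e s = eval_step z e s" for s
  proof -
    have "e s = eval_step z (cut e r s) s" unfolding e_def by (rule wfrec[OF \<open>wf r\<close>])
    also have "\<dots> = eval_step z e s"
      by (rule eval_step_cong) (auto simp: cut_def r_def)
    finally show ?thesis .
  qed
  then show ?thesis unfolding evaluation_def by blast
qed

text \<open>Exactness at an inner node needs only one implication: a failing child must be noticed
  by the truncated formula. The converse is automatic, as truncation only drops children.\<close>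

definition avoiding_set :: "(nat \<Rightarrow> nat) \<Rightarrow> (nat list \<Rightarrow> nat) \<Rightarrow> (nat \<Rightarrow> nat) set" where
  "avoiding_set z e = {t. \<not> sat t (from_nat (e [])) \<and>
     (\<forall>s n. node_label z s = 0 \<longrightarrow> \<not> sat t (from_nat (e (s @ [n]))) \<longrightarrow> sat t (from_nat (e s)))}"

lemma closed_avoiding_set: "closed (avoiding_set z e)"
proof -
  have "avoiding_set z e = - {t. sat t (from_nat (e []))} \<inter>
    (\<Inter>s\<in>{s. node_label z s = 0}. \<Inter>n. {t. sat t (from_nat (e (s @ [n])))} \<union> {t. sat t (from_nat (e s))})"
    unfolding avoiding_set_def by blast
  also have "closed \<dots>"
    using clopen_sat by (intro closed_Int closed_Compl closed_INT closed_Un ballI) blast+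
  finally show ?thesis .
qed

lemma sat_evaluation_node:
  assumes "evaluation z e" "node_label z s = 0"
  shows "sat t (from_nat (e s)) \<longleftrightarrow> (\<exists>n<(LEAST N. good_cut z e s N). \<not> sat t (from_nat (e (s @ [n]))))"
proof -
  have "e s = eval_step z e s" using assms(1) unfolding evaluation_def by (rule spec)
  then have "(from_nat (e s) :: form) = Nand (map (\<lambda>n. from_nat (e (s @ [n]))) [0..<(LEAST N. good_cut z e s N)])"
    by (simp add: eval_step_def assms(2))
  then show ?thesis by (auto simp: Bex_def)
qed

lemma sat_evaluation_iff:
  assumes wf: "code_wf (node_label z) s" and e: "evaluation z e" and S: "code_sets (node_label z) S"
    and t: "\<And>s n. node_label z s = 0 \<Longrightarrow> \<not> sat t (from_nat (e (s @ [n]))) \<Longrightarrow> sat t (from_nat (e s))"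
  shows "sat t (from_nat (e s)) \<longleftrightarrow> (z, t) \<in> S s"
proof -
  have leaf_case: "sat t (from_nat (e s)) \<longleftrightarrow> (z, t) \<in> S s" if "node_label z s \<noteq> 0" for s
  proof -
    have "e s = eval_step z e s" using e unfolding evaluation_def by (rule spec)
    moreover have "S s = (if node_label z s = 0 then \<Union>n. - S (s @ [n]) else atom_set (node_label z s - 1))"
      using S unfolding code_sets_def by (rule spec)
    ultimately show ?thesis using that by (simp add: eval_step_def sat_leaf_form)
  qed
  show ?thesis
    using wf
  proof induction
    case (leaf s)
    then show ?case by (rule leaf_case)
  next
    case (node s)
    show ?case
    proof (cases "node_label z s = 0")
      case True
      have "S s = (if node_label z s = 0 then \<Union>n. - S (s @ [n]) else atom_set (node_label z s - 1))"
        using S unfolding code_sets_def by (rule spec)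
      then have "(z, t) \<in> S s \<longleftrightarrow> (\<exists>n. \<not> sat t (from_nat (e (s @ [n]))))"
        using True node.IH by simp
      then show ?thesis using sat_evaluation_node[OF e True] t[OF True] by blast
    qed (rule leaf_case)
  qed
qed

lemma avoiding_set_avoids:
  assumes "code_wf (node_label z) []" "evaluation z e" "code_sets (node_label z) S" "t \<in> avoiding_set z e"
  shows "(z, t) \<notin> S []"
  using sat_evaluation_iff[OF assms(1,2,3), of t] assms(4) unfolding avoiding_set_def by blast

text \<open>\<open>W s\<close> is the truncation error at node \<open>s\<close>. The errors total at
  most one half, and outside them the root formula decides membership in \<open>S []\<close>
  correctly. Were the avoiding set empty, the errors and the null section would cover the whole
  space.\<close>

lemma avoiding_set_nonempty:
  assumes m: "prob_space m" "sets m = sets borel"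
    and bits: "\<And>s N l. large_bit z (to_nat (s :: nat list, N :: nat, l :: nat list)) = 0 \<longleftrightarrow>
      emeasure m {t. (\<exists>c\<in>set l. \<not> sat t (from_nat c)) \<and> (\<forall>c\<in>set (take N l). sat t (from_nat c))}
        \<le> (1/2) ^ Suc (Suc (to_nat s))"
    and wf: "\<And>s. code_wf (node_label z) s" and e: "evaluation z e" and S: "code_sets (node_label z) S"
    and null: "{t. (z, t) \<in> S []} \<in> null_sets m"
  shows "avoiding_set z e \<noteq> {}"
proof
  have half_eq: "(1/2 :: ennreal) ^ k = ennreal ((1/2) ^ k)" for k
  proof -
    have "(1/2 :: ennreal) = ennreal (1/2)" using divide_ennreal[of 1 2] by simp
    then show ?thesis by (simp only: ennreal_power)
  qed
  have half_pos: "0 < (1/2 :: ennreal) ^ k" for k unfolding half_eq by simp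
  interpret prob_space m by (rule m)
  assume empty: "avoiding_set z e = {}"
  define Q where "Q s = {t. sat t (from_nat (e s))}" for s
  have Q_sets: "Q s \<in> sets m" for s unfolding Q_def m(2) using clopen_sat borel_open by blast
  define W where "W s = (if node_label z s = 0 then (\<Union>n. - Q (s @ [n])) - Q s else {})" for s
  have sp: "space m = UNIV" using m(2) sets_eq_imp_space_eq by fastforce
  have Qc_sets: "- Q s \<in> sets m" for s using Q_sets[of s] sets.compl_sets[of "Q s" m] by (simp add: sp Compl_eq_Diff_UNIV)
  have W_sets: "W s \<in> sets m" for s unfolding W_def using Q_sets Qc_sets by auto
  have W_small: "emeasure m (W s) \<le> (1/2) ^ Suc (Suc (to_nat s))" for s
  proof (cases "node_label z s = 0")
    case True
    define G where "G k = (\<Union>n<k. - Q (s @ [n]))" for k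
    have G_sets: "G k \<in> sets m" for k unfolding G_def using Qc_sets by auto
    have G_mono: "G i \<subseteq> G j" if "i \<le> j" for i j using that unfolding G_def by (intro UN_mono) auto
    \<comment> \<open>For the list of children the bits speak of the increasing sets
      \<open>G M\<close>; a good cut bounds \<open>G M - G N\<close> for all \<open>M\<close> at
      once, and so also the union of these sets.\<close>
    have cut_iff: "good_cut z e s N \<longleftrightarrow> (\<forall>M. emeasure m (G M - G N) \<le> (1/2) ^ Suc (Suc (to_nat s)))" for N
    proof -
      have "{t. (\<exists>c\<in>set (map (\<lambda>n. e (s @ [n])) [0..<M]). \<not> sat t (from_nat c)) \<and>
             (\<forall>c\<in>set (take N (map (\<lambda>n. e (s @ [n])) [0..<M])). sat t (from_nat c))} = G M - G N" for M
      proof (cases "N \<le> M")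
        case True
        then show ?thesis by (auto simp: G_def Q_def take_map take_upt)
      next
        case False
        then have "G M \<subseteq> G N" by (intro G_mono) simp
        then show ?thesis using False by auto
      qed
      then show ?thesis unfolding good_cut_def bits by simp
    qed
    \<comment> \<open>Continuity from above: the parts left out shrink to the empty set, so a good
      cut exists and \<open>LEAST\<close> finds one.\<close>
    have "(INF N. emeasure m ((\<Union>k. G k) - G N)) = emeasure m (\<Inter>N. (\<Union>k. G k) - G N)"
    proof (rule INF_emeasure_decseq)
      show "range (\<lambda>N. (\<Union>k. G k) - G N) \<subseteq> sets m" using G_sets by auto
      show "decseq (\<lambda>N. (\<Union>k. G k) - G N)" using G_mono by (intro antimonoI Diff_mono) auto
    qed simp
    also have "(\<Inter>N. (\<Union>k. G k) - G N) = {}" by auto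
    finally have "(INF N. emeasure m ((\<Union>k. G k) - G N)) < (1/2) ^ Suc (Suc (to_nat s))"
      using half_pos[of "Suc (Suc (to_nat s))"] by (simp only: emeasure_empty)
    then obtain N where N: "emeasure m ((\<Union>k. G k) - G N) < (1/2) ^ Suc (Suc (to_nat s))"
      unfolding INF_less_iff by blast
    have "good_cut z e s N"
      unfolding cut_iff
    proof
      fix M
      have "emeasure m (G M - G N) \<le> emeasure m ((\<Union>k. G k) - G N)"
        using G_sets by (intro emeasure_mono) auto
      with N show "emeasure m (G M - G N) \<le> (1/2) ^ Suc (Suc (to_nat s))" by (meson less_imp_le order_trans)
    qed
    then have good: "good_cut z e s (LEAST N. good_cut z e s N)" by (rule LeastI)
    have "W s = (\<Union>M. G M - G (LEAST N. good_cut z e s N))"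
      using sat_evaluation_node[OF e True] by (auto simp: W_def True G_def Q_def)
    also have "emeasure m \<dots> = (SUP M. emeasure m (G M - G (LEAST N. good_cut z e s N)))"
    proof (rule SUP_emeasure_incseq[symmetric])
      show "range (\<lambda>M. G M - G (LEAST N. good_cut z e s N)) \<subseteq> sets m" using G_sets by auto
      show "incseq (\<lambda>M. G M - G (LEAST N. good_cut z e s N))"
        using G_mono by (intro monoI Diff_mono) auto
    qed
    also have "\<dots> \<le> (1/2) ^ Suc (Suc (to_nat s))"
      using good unfolding cut_iff by (intro SUP_least) blast
    finally show ?thesis .
  qed (simp add: W_def)
  define U where "U i = (if i \<in> range (to_nat :: nat list \<Rightarrow> nat) then W (from_nat i) else {})" for i
  have "(\<Union>s. W s) \<subseteq> (\<Union>i. U i)"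
  proof (rule UN_least)
    fix s show "W s \<subseteq> (\<Union>i. U i)" by (rule subset_trans[OF _ UN_upper[of "to_nat s"]]) (simp_all add: U_def)
  qed
  then have "emeasure m (\<Union>s. W s) \<le> emeasure m (\<Union>i. U i)"
    using W_sets by (intro emeasure_mono) (auto simp: U_def)
  also have "\<dots> \<le> (\<Sum>i. emeasure m (U i))"
    using W_sets by (intro emeasure_subadditive_countably) (auto simp: U_def)
  also have "\<dots> \<le> (\<Sum>i. (1/2) ^ Suc (Suc i))"
    using W_small by (intro suminf_le) (auto simp: U_def)
  \<comment> \<open>The exponent \<open>Suc (Suc i)\<close>, one more than in the geometric series
    with sum 1, gives one half.\<close>
  also have "\<dots> = ennreal (1/2)"
    unfolding half_eq
    using sums_mult[OF power_half_series, of "1/2"] by (intro suminf_ennreal_eq) simp_all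
  finally have W_half: "emeasure m (\<Union>s. W s) \<le> ennreal (1/2)" .
  have "UNIV \<subseteq> (\<Union>s. W s) \<union> {t. (z, t) \<in> S []}"
  proof
    fix t
    show "t \<in> (\<Union>s. W s) \<union> {t. (z, t) \<in> S []}"
    proof (cases "t \<in> (\<Union>s. W s)")
      case False
      have t: "sat t (from_nat (e s))" if "node_label z s = 0" "\<not> sat t (from_nat (e (s @ [n])))" for s n
      proof (rule ccontr)
        assume "\<not> sat t (from_nat (e s))"
        then have "t \<in> W s" using that by (auto simp: W_def Q_def)
        with False show False by blast
      qed
      moreover have "t \<notin> avoiding_set z e" using empty by simp
      ultimately have "sat t (from_nat (e []))" unfolding avoiding_set_def by blast
      moreover have "sat t (from_nat (e [])) \<longleftrightarrow> (z, t) \<in> S []"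
        by (rule sat_evaluation_iff[OF wf e S]) (rule t)
      ultimately have "(z, t) \<in> S []" by simp
      then show ?thesis by simp
    qed simp
  qed
  then have "emeasure m UNIV \<le> emeasure m ((\<Union>s. W s) \<union> {t. (z, t) \<in> S []})"
    using W_sets null by (intro emeasure_mono) auto
  also have "\<dots> = emeasure m (\<Union>s. W s)"
    using W_sets null by (intro emeasure_Un_null_set) auto
  also note W_half
  finally have "ennreal 1 \<le> ennreal (1/2)" using emeasure_space_1 by (simp add: sp)
  then show False by (subst (asm) ennreal_le_iff) simp_all
qed

section \<open>Borel measurability of the evaluation\<close>

lemma measurable_count_space_binary:
  fixes f :: "'a \<Rightarrow> 'i::countable" and g :: "'a \<Rightarrow> 'j::countable"
  assumes f: "f \<in> M \<rightarrow>\<^sub>M count_space UNIV" and g: "g \<in> M \<rightarrow>\<^sub>M count_space UNIV"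
  shows "(\<lambda>x. h (f x) (g x)) \<in> M \<rightarrow>\<^sub>M count_space UNIV"
proof (rule measurable_compose_countable[OF _ f])
  fix i show "(\<lambda>x. h i (g x)) \<in> M \<rightarrow>\<^sub>M count_space UNIV"
    by (rule measurable_compose[OF g]) simp
qed

lemma measurable_map_upt:
  fixes f :: "'a \<Rightarrow> nat \<Rightarrow> 'i::countable"
  assumes "\<And>n. (\<lambda>x. f x n) \<in> M \<rightarrow>\<^sub>M count_space UNIV"
  shows "(\<lambda>x. map (f x) [0..<k]) \<in> M \<rightarrow>\<^sub>M count_space UNIV"
proof (induction k)
  case (Suc k)
  from measurable_count_space_binary[OF Suc assms[of k], of "\<lambda>xs a. xs @ [a]"] show ?case by simp
qed simp

lemma pred_sat:
  assumes T: "T \<in> borel_measurable M" and f: "f \<in> M \<rightarrow>\<^sub>M count_space UNIV"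
  shows "Measurable.pred M (\<lambda>x. sat (T x) (f x))"
proof (rule measurable_compose_countable[OF _ f])
  fix \<phi>
  have "{t. sat t \<phi>} \<in> sets borel" using clopen_sat borel_open by blast
  then have "Measurable.pred borel (\<lambda>t. sat t \<phi>)" by (simp add: pred_def)
  from measurable_compose[OF T this] show "Measurable.pred M (\<lambda>x. sat (T x) \<phi>)" .
qed

lemma measurable_node_label:
  assumes "Z \<in> borel_measurable M"
  shows "(\<lambda>x. node_label (Z x) s) \<in> M \<rightarrow>\<^sub>M count_space UNIV"
  unfolding node_label_def
  by (rule measurable_compose[OF measurable_nat_coordinate[OF assms, of "to_nat s"]]) simp

lemma measurable_large_bit:
  assumes "Z \<in> borel_measurable M"
  shows "(\<lambda>x. large_bit (Z x) m) \<in> M \<rightarrow>\<^sub>M count_space UNIV"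
  unfolding large_bit_def
  by (rule measurable_compose[OF measurable_nat_coordinate[OF assms, of m]]) simp

lemma pred_good_cut:
  assumes Z: "Z \<in> borel_measurable M" and E: "E \<in> borel_measurable M"
  shows "Measurable.pred M (\<lambda>x. good_cut (Z x) (E x) s N)"
  unfolding good_cut_def
proof (rule pred_intros_countable)
  fix k
  have l: "(\<lambda>x. map (\<lambda>n. E x (s @ [n])) [0..<k]) \<in> M \<rightarrow>\<^sub>M count_space UNIV"
    by (intro measurable_map_upt measurable_nat_coordinate E)
  have "(\<lambda>x. large_bit (Z x) (to_nat (s, N, map (\<lambda>n. E x (s @ [n])) [0..<k]))) \<in> M \<rightarrow>\<^sub>M count_space UNIV"
    by (rule measurable_compose_countable[OF measurable_large_bit[OF Z] l])
  then show "Measurable.pred M (\<lambda>x. large_bit (Z x) (to_nat (s, N, map (\<lambda>n. E x (s @ [n])) [0..<k])) = 0)"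
    by (rule measurable_compose) simp
qed

lemma measurable_leaf_form:
  assumes Z: "Z \<in> borel_measurable M"
  shows "(\<lambda>x. leaf_form (Z x) k) \<in> M \<rightarrow>\<^sub>M count_space UNIV"
proof -
  obtain b m i j where k: "prod_decode k = (b, m)" "prod_decode m = (i, j)" by (metis surj_pair)
  have "(\<lambda>x. (\<lambda>a. if b = 0 then (if a = j then Nand [Nand []] else Nand []) else Atom i j) (Z x i))
      \<in> M \<rightarrow>\<^sub>M count_space UNIV"
    by (rule measurable_compose[OF measurable_nat_coordinate[OF Z, of i]]) simp
  then show ?thesis by (simp add: leaf_form_def k)
qed

text \<open>The cut and the label vary with the point but take countably many values, so each value
  can be treated separately.\<close>

lemma measurable_eval_step:
  assumes Z: "Z \<in> borel_measurable M" and E: "E \<in> borel_measurable M"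
  shows "(\<lambda>x. eval_step (Z x) (E x) s) \<in> M \<rightarrow>\<^sub>M count_space UNIV"
  unfolding eval_step_def
proof (rule measurable_If)
  have "(\<lambda>x. map (\<lambda>n. from_nat (E x (s @ [n]))) [0..<N]) \<in> M \<rightarrow>\<^sub>M (count_space UNIV :: form list measure)" for N
    by (intro measurable_map_upt measurable_compose[OF measurable_nat_coordinate[OF E]]) simp
  then have "(\<lambda>x. to_nat (Nand (map (\<lambda>n. from_nat (E x (s @ [n]))) [0..<N]))) \<in> M \<rightarrow>\<^sub>M count_space UNIV" for N
    by (rule measurable_compose) simp
  moreover have "(\<lambda>x. LEAST N. good_cut (Z x) (E x) s N) \<in> M \<rightarrow>\<^sub>M count_space UNIV"
    by (rule measurable_Least) (rule pred_good_cut[OF Z E])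
  ultimately show "(\<lambda>x. to_nat (Nand (map (\<lambda>n. from_nat (E x (s @ [n])))
      [0..<(LEAST N. good_cut (Z x) (E x) s N)]))) \<in> M \<rightarrow>\<^sub>M count_space UNIV"
    by (rule measurable_compose_countable)
  have "(\<lambda>x. leaf_form (Z x) (node_label (Z x) s - 1)) \<in> M \<rightarrow>\<^sub>M count_space UNIV"
    by (rule measurable_compose_countable[OF measurable_leaf_form[OF Z]])
      (rule measurable_compose[OF measurable_node_label[OF Z]], simp)
  then show "(\<lambda>x. to_nat (leaf_form (Z x) (node_label (Z x) s - 1))) \<in> M \<rightarrow>\<^sub>M count_space UNIV"
    by (rule measurable_compose) simp
  have "Measurable.pred M (\<lambda>x. node_label (Z x) s = 0)"
    by (rule measurable_compose[OF measurable_node_label[OF Z]]) simp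
  then show "{x \<in> space M. node_label (Z x) s = 0} \<in> sets M" by (simp add: pred_def)
qed

lemma pred_evaluation:
  assumes Z: "Z \<in> borel_measurable M" and E: "E \<in> borel_measurable M"
  shows "Measurable.pred M (\<lambda>x. evaluation (Z x) (E x))"
  unfolding evaluation_def
  by (intro pred_intros_countable
      measurable_count_space_binary[OF measurable_nat_coordinate[OF E] measurable_eval_step[OF Z E]])

lemma pred_avoiding_set:
  assumes Z: "Z \<in> borel_measurable M" and E: "E \<in> borel_measurable M" and T: "T \<in> borel_measurable M"
  shows "Measurable.pred M (\<lambda>x. T x \<in> avoiding_set (Z x) (E x))"
proof -
  have [measurable]: "Measurable.pred M (\<lambda>x. sat (T x) (from_nat (E x s)))" for s
    by (rule pred_sat[OF T measurable_compose[OF measurable_nat_coordinate[OF E]]]) simp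
  have [measurable]: "Measurable.pred M (\<lambda>x. node_label (Z x) s = 0)" for s
    by (rule measurable_compose[OF measurable_node_label[OF Z]]) simp
  show ?thesis unfolding avoiding_set_def mem_Collect_eq by measurable
qed

lemma pred_lex_less:
  assumes S: "S \<in> borel_measurable M" and T: "T \<in> borel_measurable M"
  shows "Measurable.pred M (\<lambda>x. lex_less (S x) (T x))"
proof -
  have [measurable]: "Measurable.pred M (\<lambda>x. S x i = T x i)" "Measurable.pred M (\<lambda>x. S x i < T x i)" for i
    by (rule measurable_count_space_binary[OF measurable_nat_coordinate[OF S] measurable_nat_coordinate[OF T]])+
  show ?thesis unfolding lex_less_def by measurable
qed

lemma pred_path_labels:
  assumes Z: "Z \<in> borel_measurable M" and p: "p \<in> borel_measurable M"
  shows "Measurable.pred M (\<lambda>x. \<exists>m. \<forall>n\<ge>m. node_label (Z x) (map (p x) [0..<n]) = 0)"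
proof -
  have "(\<lambda>x. node_label (Z x) (map (p x) [0..<n])) \<in> M \<rightarrow>\<^sub>M count_space UNIV" for n
    by (rule measurable_compose_countable[OF measurable_node_label[OF Z]])
      (intro measurable_map_upt measurable_nat_coordinate p)
  then have [measurable]: "Measurable.pred M (\<lambda>x. node_label (Z x) (map (p x) [0..<n]) = 0)" for n
    by (rule measurable_compose) simp
  show ?thesis by measurable
qed

section \<open>The coanalytic set\<close>

definition selected :: "(nat \<Rightarrow> nat) \<Rightarrow> (nat \<Rightarrow> nat) \<Rightarrow> bool" where
  "selected z t \<longleftrightarrow> (\<forall>s. code_wf (node_label z) s) \<and>
     (\<forall>e. evaluation z e \<longrightarrow> t \<in> avoiding_set z e \<and> (\<forall>t'\<in>avoiding_set z e. \<not> lex_less t' t))"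

text \<open>Well-foundedness provides an evaluation, so the quantifier over \<open>e\<close> is not
  vacuous and both points are least in the same set.\<close>

lemma selected_unique:
  assumes "selected z t" "selected z t'"
  shows "t = t'"
proof -
  obtain e where "evaluation z e"
    using evaluation_exists[of z] assms(1) unfolding selected_def by blast
  then have "\<not> lex_less t t'" "\<not> lex_less t' t"
    using assms unfolding selected_def by blast+
  then show ?thesis using lex_less_linear by blast
qed

text \<open>\<open>a\<close> packs the labels of a code of \<open>D\<close> with the bits of
  \<open>m\<close>. Both are fixed before \<open>z\<close>, so every \<open>z\<close> with these
  first components works, whatever its second components are.\<close>

lemma selected_avoids:
  assumes D: "D \<in> sets (borel :: ((nat \<Rightarrow> nat) \<times> (nat \<Rightarrow> nat)) measure)"
    and m: "prob_space m" "sets m = sets borel"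
  shows "\<exists>a. \<forall>z. (\<forall>n. fst (prod_decode (z n)) = a n) \<longrightarrow> {t. (z, t) \<in> D} \<in> null_sets m \<longrightarrow>
    (\<exists>t. selected z t \<and> (z, t) \<notin> D)"
proof -
  obtain lab S where lab: "\<forall>s. code_wf lab s" and S: "code_sets lab S" "S [] = D"
    using borel_code_exists[OF D] by blast
  define sm where "sm s N l \<longleftrightarrow>
      emeasure m {t. (\<exists>c\<in>set l. \<not> sat t (from_nat c)) \<and> (\<forall>c\<in>set (take N l). sat t (from_nat c))}
        \<le> (1/2) ^ Suc (Suc (to_nat s))" for s :: "nat list" and N :: nat and l :: "nat list"
  define bit where "bit n = (case from_nat n of (s, N, l) \<Rightarrow> (if sm s N l then 0 else (1 :: nat)))" for n
  define a where "a n = prod_encode (lab (from_nat n), bit n)" for n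
  show ?thesis
  proof (rule exI[of _ a], intro allI impI)
    fix z assume z: "\<forall>n. fst (prod_decode (z n)) = a n" and null: "{t. (z, t) \<in> D} \<in> null_sets m"
    have nl: "node_label z = lab"
      by (intro ext) (simp add: node_label_def z a_def)
    have lb: "large_bit z n = bit n" for n by (simp add: large_bit_def z a_def)
    have wf: "code_wf (node_label z) s" for s using lab by (simp add: nl)
    obtain e where e: "evaluation z e" using evaluation_exists[OF wf] by blast
    have bits: "large_bit z (to_nat (s :: nat list, N :: nat, l :: nat list)) = 0 \<longleftrightarrow>
        emeasure m {t. (\<exists>c\<in>set l. \<not> sat t (from_nat c)) \<and> (\<forall>c\<in>set (take N l). sat t (from_nat c))}
        \<le> (1/2) ^ Suc (Suc (to_nat s))" for s N l
      unfolding sm_def[symmetric] lb bit_def by simp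
    have Sz: "code_sets (node_label z) S" using S by (simp add: nl)
    have "{t. (z, t) \<in> S []} \<in> null_sets m" using null S by simp
    from avoiding_set_nonempty[OF m bits wf e Sz this] have "avoiding_set z e \<noteq> {}" .
    then obtain t where t: "t \<in> avoiding_set z e" "\<forall>s\<in>avoiding_set z e. \<not> lex_less s t"
      using closed_lex_least_exists[OF closed_avoiding_set] by blast
    have "e' = e" if "evaluation z e'" for e' using evaluation_unique[OF wf that e] .
    then have "selected z t" unfolding selected_def using wf t by blast
    moreover have "(z, t) \<notin> D"
      using avoiding_set_avoids[OF wf e Sz t(1)] S(2) by simp
    ultimately show "\<exists>t. selected z t \<and> (z, t) \<notin> D" by blast
  qed
qed

lemma universally_measurable_Compl:
  assumes "universally_measurable (- B)"
  shows "universally_measurable B"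
  unfolding universally_measurable_def
proof (intro allI impI)
  fix \<mu> :: "'a measure" assume \<mu>: "borel_probability \<mu>"
  then have "space (completion \<mu>) = UNIV"
    unfolding borel_probability_def using sets_eq_imp_space_eq[of \<mu> borel] by simp
  moreover have "- B \<in> sets (completion \<mu>)"
    using assms \<mu> unfolding universally_measurable_def by blast
  ultimately show "B \<in> sets (completion \<mu>)"
    using sets.compl_sets[of "- B" "completion \<mu>"] by (simp add: Compl_eq_Diff_UNIV double_diff)
qed

definition selected_points ::
  "((nat \<Rightarrow> nat) \<Rightarrow> 'a::ab_group_add) \<Rightarrow> ((nat \<Rightarrow> nat) \<Rightarrow> 'a set) \<Rightarrow> ('a \<Rightarrow> nat \<Rightarrow> nat) \<Rightarrow> 'a set" where
  "selected_points g K \<tau> = {g z + x | z x. x \<in> K z \<and> selected z (\<tau> x)}"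

text \<open>A witness is a triple of \<open>z\<close>, a sequence \<open>p\<close> and an evaluation
  \<open>e\<close>. The sequence has two uses: as a path showing that the code is ill-founded, or as
  a lexicographically smaller point of the avoiding set.\<close>

lemma Compl_selected_points_projection:
  fixes g :: "(nat \<Rightarrow> nat) \<Rightarrow> 'a::{topological_ab_group_add, polish_space}"
  assumes g: "continuous_on UNIV g" and K: "closed {p. snd p \<in> K (fst p)}"
    and F: "closed {g z + x | z x. x \<in> K z}" and \<tau>: "\<tau> \<in> borel_measurable borel"
    and inj: "\<And>z z' x x'. x \<in> K z \<Longrightarrow> x' \<in> K z' \<Longrightarrow> g z + x = g z' + x' \<Longrightarrow> z = z'"
  shows "\<exists>D :: ('a \<times> (nat \<Rightarrow> nat) \<times> (nat \<Rightarrow> nat) \<times> (nat list \<Rightarrow> nat)) set.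
    D \<in> sets borel \<and> fst ` D = - selected_points g K \<tau>"
proof -
  define F where "F = {g z + x | z x. x \<in> K z}"
  define B :: "('a \<times> (nat \<Rightarrow> nat) \<times> (nat \<Rightarrow> nat) \<times> (nat list \<Rightarrow> nat)) measure" where "B = borel"
  define Z where "Z w = fst (snd w)" for w :: "'a \<times> (nat \<Rightarrow> nat) \<times> (nat \<Rightarrow> nat) \<times> (nat list \<Rightarrow> nat)"
  define p where "p w = fst (snd (snd w))" for w :: "'a \<times> (nat \<Rightarrow> nat) \<times> (nat \<Rightarrow> nat) \<times> (nat list \<Rightarrow> nat)"
  define E where "E w = snd (snd (snd w))" for w :: "'a \<times> (nat \<Rightarrow> nat) \<times> (nat \<Rightarrow> nat) \<times> (nat list \<Rightarrow> nat)"
  define X where "X w = fst w - g (Z w)" for w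
  have Zc: "continuous_on UNIV Z" unfolding Z_def by (intro continuous_intros)
  have gZ: "continuous_on UNIV (\<lambda>w. g (Z w))"
    by (rule continuous_on_compose2[OF g Zc]) simp
  have Xc: "continuous_on UNIV X" unfolding X_def by (intro continuous_on_diff continuous_on_fst continuous_on_id gZ)
  have Zm: "Z \<in> borel_measurable B" unfolding B_def by (rule borel_measurable_continuous_onI[OF Zc])
  have pm: "p \<in> borel_measurable B"
    unfolding B_def p_def by (intro borel_measurable_continuous_onI continuous_intros)
  have Em: "E \<in> borel_measurable B"
    unfolding B_def E_def by (intro borel_measurable_continuous_onI continuous_intros)
  have Xm: "X \<in> borel_measurable B" unfolding B_def by (rule borel_measurable_continuous_onI[OF Xc])
  have Tm: "(\<lambda>w. \<tau> (X w)) \<in> borel_measurable B" by (rule measurable_compose[OF Xm \<tau>])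
  have Fm: "Measurable.pred B (\<lambda>w. fst w \<in> F)"
  proof -
    have "closed (fst -` F :: ('a \<times> (nat \<Rightarrow> nat) \<times> (nat \<Rightarrow> nat) \<times> (nat list \<Rightarrow> nat)) set)"
      using F unfolding F_def by (intro closed_vimage continuous_intros)
    then show ?thesis by (simp add: pred_def B_def vimage_def borel_closed)
  qed
  have Km: "Measurable.pred B (\<lambda>w. X w \<in> K (Z w))"
  proof -
    have "closed ((\<lambda>w. (Z w, X w)) -` {p. snd p \<in> K (fst p)})"
      by (intro closed_vimage[OF K] continuous_on_Pair Zc Xc)
    then show ?thesis by (simp add: pred_def B_def vimage_def borel_closed)
  qed
  define D where "D = {w \<in> space B. fst w \<notin> F \<or> (X w \<in> K (Z w) \<and>
    ((\<exists>m. \<forall>n\<ge>m. node_label (Z w) (map (p w) [0..<n]) = 0) \<or>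
     (evaluation (Z w) (E w) \<and> (\<tau> (X w) \<notin> avoiding_set (Z w) (E w) \<or>
       (p w \<in> avoiding_set (Z w) (E w) \<and> lex_less (p w) (\<tau> (X w)))))))}"
  have "D \<in> sets B"
    unfolding D_def pred_def[symmetric]
    by (intro Fm Km pred_path_labels[OF Zm pm] pred_evaluation[OF Zm Em] pred_avoiding_set[OF Zm Em Tm]
        pred_avoiding_set[OF Zm Em pm] pred_lex_less[OF pm Tm] pred_intros_logic)
  moreover have "fst ` D = - selected_points g K \<tau>"
  proof (intro subset_antisym subsetI)
    fix y assume "y \<in> fst ` D"
    then obtain w where w: "w \<in> D" "y = fst w" by blast
    show "y \<in> - selected_points g K \<tau>"
    proof
      assume "y \<in> selected_points g K \<tau>"
      then obtain z x where zx: "y = g z + x" "x \<in> K z" "selected z (\<tau> x)"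
        unfolding selected_points_def by blast
      then have "fst w \<in> F" unfolding F_def w(2)[symmetric] by blast
      with w(1) have XK: "X w \<in> K (Z w)" and *: "(\<exists>m. \<forall>n\<ge>m. node_label (Z w) (map (p w) [0..<n]) = 0) \<or>
         (evaluation (Z w) (E w) \<and> (\<tau> (X w) \<notin> avoiding_set (Z w) (E w) \<or>
         (p w \<in> avoiding_set (Z w) (E w) \<and> lex_less (p w) (\<tau> (X w)))))"
        unfolding D_def by blast+
      have "g (Z w) + X w = g z + x" using zx(1) w(2) by (simp add: X_def)
      \<comment> \<open>By separation a point determines its \<open>z\<close>; otherwise a witness
        for one \<open>z\<close> would say nothing about selection by another.\<close>
      then have Zw: "Z w = z" using inj[OF XK zx(2)] by simp
      then have Xw: "X w = x" using \<open>g (Z w) + X w = g z + x\<close> by simp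
      have "\<not> (\<exists>p m. \<forall>n\<ge>m. node_label z (map p [0..<n]) = 0)"
        using zx(3) unfolding selected_def all_code_wf_iff by (rule conjunct1)
      then show False using * zx(3) unfolding Zw Xw selected_def by blast
    qed
  next
    fix y assume y: "y \<in> - selected_points g K \<tau>"
    show "y \<in> fst ` D"
    proof (cases "y \<in> F")
      case False
      then have "(y, \<lambda>_. 0, \<lambda>_. 0, \<lambda>_. 0) \<in> D" by (simp add: D_def B_def)
      then show ?thesis by (force simp: image_iff)
    next
      case True
      then obtain z x where zx: "y = g z + x" "x \<in> K z" unfolding F_def by blast
      then have "\<not> selected z (\<tau> x)" using y unfolding selected_points_def by blast
      then consider q where "\<exists>m. \<forall>n\<ge>m. node_label z (map q [0..<n]) = 0"
        | e where "evaluation z e" "\<tau> x \<notin> avoiding_set z e"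
        | e t where "evaluation z e" "t \<in> avoiding_set z e" "lex_less t (\<tau> x)"
        unfolding selected_def all_code_wf_iff by blast
      then have "\<exists>w. w \<in> D \<and> fst w = y"
      proof cases
        case 1
        then have "(y, z, q, \<lambda>_. 0) \<in> D" using zx by (simp add: D_def B_def X_def Z_def p_def E_def)
        then show ?thesis by (intro exI) (rule conjI, assumption, simp)
      next
        case 2
        then have "(y, z, \<lambda>_. 0, e) \<in> D" using zx by (simp add: D_def B_def X_def Z_def p_def E_def)
        then show ?thesis by (intro exI) (rule conjI, assumption, simp)
      next
        case 3
        then have "(y, z, t, e) \<in> D" using zx by (simp add: D_def B_def X_def Z_def p_def E_def)
        then show ?thesis by (intro exI) (rule conjI, assumption, simp)
      qed
      then show ?thesis by force
    qed
  qed
  ultimately show ?thesis unfolding B_def by blast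
qed

text \<open>A witnessing measure is restricted to a compact set and moved to Baire space by
  \<open>\<tau>\<close>. With \<open>z\<close> carrying the data of \<open>D\<close> and of this
  measure, the point selected for \<open>z\<close> lies outside \<open>B\<close>.\<close>

lemma selected_points_not_haar_null:
  fixes g :: "(nat \<Rightarrow> nat) \<Rightarrow> 'a::{topological_ab_group_add, polish_space}"
  assumes g: "continuous_on UNIV g" and K: "closed {p. snd p \<in> K (fst p)}"
    and cover: "\<And>K0 a. compact K0 \<Longrightarrow> \<exists>z. (\<forall>n. fst (prod_decode (z n)) = a n) \<and> K0 \<subseteq> K z"
    and \<tau>: "\<tau> \<in> borel_measurable borel" and \<kappa>: "\<kappa> \<in> borel_measurable borel" and \<kappa>\<tau>: "\<And>x. \<kappa> (\<tau> x) = x"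
  shows "\<not> haar_null (selected_points g K \<tau>)"
proof
  assume "haar_null (selected_points g K \<tau>)"
  then obtain B \<nu> where B: "B \<in> sets borel" "selected_points g K \<tau> \<subseteq> B"
    and \<nu>: "prob_space \<nu>" "sets \<nu> = sets borel" and null: "\<And>h. emeasure \<nu> ((\<lambda>x. x + h) ` B) = 0"
    unfolding haar_null_def borel_probability_def by blast
  interpret \<nu>: prob_space \<nu> by (rule \<nu>)
  have sp: "space \<nu> = UNIV" using sets_eq_imp_space_eq[OF \<nu>(2)] by simp
  \<comment> \<open>Inner regularity supplies a compact set that some \<open>K z\<close> will
    contain.\<close>
  obtain K0 where K0: "compact K0" "emeasure \<nu> K0 > 0"
  proof -
    have "(0 :: ennreal) < 1" by simp
    also have "1 = emeasure \<nu> UNIV" using \<nu>.emeasure_space_1 by (simp add: sp)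
    also have "\<dots> = (SUP K \<in> {K. K \<subseteq> UNIV \<and> compact K}. emeasure \<nu> K)"
      by (rule inner_regular[OF \<nu>(2)]) simp_all
    finally show thesis using that unfolding less_SUP_iff by blast
  qed
  have K0_sets: "K0 \<in> sets \<nu>" using K0(1) by (simp add: \<nu>(2) borel_closed compact_imp_closed)
  define u where "u = uniform_measure \<nu> K0"
  have u: "prob_space u" "sets u = sets borel"
    unfolding u_def using K0(2) \<nu>(2) by (auto intro!: prob_space_uniform_measure)
  have spu: "space u = UNIV" using sets_eq_imp_space_eq[OF u(2)] by simp
  have \<tau>u: "\<tau> \<in> u \<rightarrow>\<^sub>M borel" using \<tau> by (simp add: measurable_cong_sets[OF u(2) refl])
  define m where "m = distr u borel \<tau>"
  have m: "prob_space m" "sets m = sets borel"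
    unfolding m_def using u \<tau>u by (auto intro!: prob_space.prob_space_distr)
  \<comment> \<open>All useless points are put into \<open>D\<close>: those that are not values of
    \<open>\<tau>\<close>, those naming a point outside \<open>K z\<close>, and those leading into
    \<open>B\<close>. Avoiding \<open>D\<close> thus yields an honest point of
    \<open>K z\<close>.\<close>
  define D where "D = {w \<in> space (borel \<Otimes>\<^sub>M borel). \<not> (\<tau> (\<kappa> (snd w)) = snd w \<and>
    \<kappa> (snd w) \<in> K (fst w) \<and> g (fst w) + \<kappa> (snd w) \<notin> B)}"
  have D: "D \<in> sets borel"
  proof -
    let ?M = "(borel \<Otimes>\<^sub>M borel) :: ((nat \<Rightarrow> nat) \<times> (nat \<Rightarrow> nat)) measure"
    have s: "snd \<in> borel_measurable ?M" and f: "fst \<in> borel_measurable ?M" by simp_all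
    have k: "(\<lambda>w. \<kappa> (snd w)) \<in> borel_measurable ?M" by (rule measurable_compose[OF s \<kappa>])
    have t: "(\<lambda>w. \<tau> (\<kappa> (snd w))) \<in> borel_measurable ?M" by (rule measurable_compose[OF k \<tau>])
    have fk: "(\<lambda>w. (fst w, \<kappa> (snd w))) \<in> ?M \<rightarrow>\<^sub>M borel"
      using measurable_Pair[OF f k] by (simp add: borel_prod)
    have "Measurable.pred ?M (\<lambda>w. \<forall>n. \<tau> (\<kappa> (snd w)) n = snd w n)"
      by (intro pred_intros_countable
          measurable_count_space_binary[OF measurable_nat_coordinate[OF t] measurable_nat_coordinate[OF s]])
    then have [measurable]: "Measurable.pred ?M (\<lambda>w. \<tau> (\<kappa> (snd w)) = snd w)" by (simp add: fun_eq_iff)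
    have "Measurable.pred borel (\<lambda>w. snd w \<in> K (fst w))" using K by (simp add: pred_def borel_closed)
    from measurable_compose[OF fk this]
    have [measurable]: "Measurable.pred ?M (\<lambda>w. \<kappa> (snd w) \<in> K (fst w))" by simp
    have "continuous_on UNIV (\<lambda>w :: (nat \<Rightarrow> nat) \<times> 'a. g (fst w) + snd w)"
      by (intro continuous_on_add continuous_on_snd continuous_on_id
          continuous_on_compose2[OF g continuous_on_fst[OF continuous_on_id]]) simp
    from measurable_compose[OF fk borel_measurable_continuous_onI[OF this]]
    have [measurable]: "(\<lambda>w. g (fst w) + \<kappa> (snd w)) \<in> borel_measurable ?M" by simp
    note [measurable] = B(1)
    have "D \<in> sets ?M" unfolding D_def by measurable
    then show ?thesis unfolding borel_prod .
  qed
  obtain a where a: "\<And>z. (\<forall>n. fst (prod_decode (z n)) = a n) \<Longrightarrow> {t. (z, t) \<in> D} \<in> null_sets m \<Longrightarrow>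
      \<exists>t. selected z t \<and> (z, t) \<notin> D"
    using selected_avoids[OF D m] by blast
  obtain z where z: "\<forall>n. fst (prod_decode (z n)) = a n" "K0 \<subseteq> K z"
    using cover[OF K0(1)] by blast
  have "{t. (z, t) \<in> D} \<in> null_sets m"
  proof -
    have ms: "{t. (z, t) \<in> D} \<in> sets borel"
    proof -
      have "continuous_on UNIV (\<lambda>t :: nat \<Rightarrow> nat. (z, t))" by (intro continuous_intros)
      from measurable_sets[OF borel_measurable_continuous_onI[OF this] D]
      show ?thesis by (simp add: vimage_def)
    qed
    have "{x. g z + x \<in> B} \<in> sets borel"
    proof -
      have "continuous_on UNIV (\<lambda>x. g z + x)" by (intro continuous_intros)
      from measurable_sets[OF borel_measurable_continuous_onI[OF this] B(1)]
      show ?thesis by (simp add: vimage_def)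
    qed
    moreover have "{x. g z + x \<in> B} = (\<lambda>x. x + - g z) ` B"
    proof (intro subset_antisym subsetI)
      fix x assume "x \<in> {x. g z + x \<in> B}"
      then show "x \<in> (\<lambda>x. x + - g z) ` B" by (intro image_eqI[of _ _ "g z + x"]) simp_all
    qed auto
    \<comment> \<open>For points of \<open>K0\<close> the first two defects cannot occur, so only a
      translate of \<open>B\<close> remains.\<close>
    moreover have "K0 \<inter> (\<tau> -` {t. (z, t) \<in> D}) \<subseteq> {x. g z + x \<in> B}"
      using z(2) by (auto simp: D_def \<kappa>\<tau>)
    ultimately have "emeasure \<nu> (K0 \<inter> (\<tau> -` {t. (z, t) \<in> D})) \<le> 0"
      using emeasure_mono[of "K0 \<inter> (\<tau> -` {t. (z, t) \<in> D})" "{x. g z + x \<in> B}" \<nu>] null[of "- g z"]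
      by (simp add: \<nu>(2))
    moreover have "\<tau> -` {t. (z, t) \<in> D} \<in> sets \<nu>"
      using measurable_sets[OF \<tau> ms] by (simp add: \<nu>(2))
    ultimately have "emeasure u (\<tau> -` {t. (z, t) \<in> D}) = 0"
      unfolding u_def by (subst emeasure_uniform_measure[OF K0_sets]) simp_all
    moreover have "emeasure m {t. (z, t) \<in> D} = emeasure u (\<tau> -` {t. (z, t) \<in> D} \<inter> space u)"
      unfolding m_def by (rule emeasure_distr[OF \<tau>u ms])
    ultimately show ?thesis using ms by (simp add: null_sets_def m(2) spu)
  qed
  from a[OF z(1) this] obtain t where t: "selected z t" "(z, t) \<notin> D" by blast
  then have "\<tau> (\<kappa> t) = t" "\<kappa> t \<in> K z" "g z + \<kappa> t \<notin> B" by (auto simp: D_def space_pair_measure)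
  moreover from this t(1) have "g z + \<kappa> t \<in> selected_points g K \<tau>"
    unfolding selected_points_def by force
  ultimately show False using B(2) by blast
qed

lemma coanalytic_generalised_haar_null_not_haar_null:
  assumes nlc: "\<not> locally_compact_space (euclidean :: 'a::{topological_ab_group_add, polish_space} topology)"
  shows "\<exists>P :: 'a set. coanalytic_set P \<and> generalised_haar_null P \<and> \<not> haar_null P"
proof -
  obtain \<mu> :: "'a measure" and C
    where \<mu>: "borel_probability \<mu>" and C: "compact C" "emeasure \<mu> (- C) = 0"
      and atomless: "\<And>x. emeasure \<mu> {x} = 0"
    by (rule compact_atomless_measure_exists[OF nlc]) (rule that)
  have sets: "sets \<mu> = sets borel" and "prob_space \<mu>" using \<mu> unfolding borel_probability_def by auto
  obtain g :: "(nat \<Rightarrow> nat) \<Rightarrow> 'a" and K :: "(nat \<Rightarrow> nat) \<Rightarrow> 'a set"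
    where g: "continuous_on UNIV g" and "\<And>z. 0 \<in> K z"
    and K: "closed {p. snd p \<in> K (fst p)}" and F: "closed {g z + x | z x. x \<in> K z}"
    and sep: "\<And>z z' x x' c c'. x \<in> K z \<Longrightarrow> x' \<in> K z' \<Longrightarrow> c \<in> C \<Longrightarrow> c' \<in> C \<Longrightarrow>
       g z + x - (g z' + x') = c - c' \<Longrightarrow> z = z'"
    and cover: "\<And>K0 a. compact K0 \<Longrightarrow> \<exists>z. (\<forall>n. fst (prod_decode (z n)) = a n) \<and> K0 \<subseteq> K z"
    by (rule separated_compact_translates[OF nlc C(1)]) (rule that)
  obtain \<tau> :: "'a \<Rightarrow> nat \<Rightarrow> nat" and \<kappa>
    where \<tau>: "\<tau> \<in> borel_measurable borel" and \<kappa>: "\<kappa> \<in> borel_measurable borel" and \<kappa>\<tau>: "\<And>x. \<kappa> (\<tau> x) = x"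
    by (rule borel_retraction_of_baire_space) (rule that)
  define P where "P = selected_points g K \<tau>"
  have "C \<noteq> {}"
  proof
    assume "C = {}"
    with C(2) prob_space.emeasure_space_1[OF \<open>prob_space \<mu>\<close>] show False
      by (simp add: sets_eq_imp_space_eq[OF sets])
  qed
  then obtain c where "c \<in> C" by blast
  have inj: "z = z'" if "x \<in> K z" "x' \<in> K z'" "g z + x = g z' + x'" for z z' x x'
    using sep[OF that(1,2) \<open>c \<in> C\<close> \<open>c \<in> C\<close>] that(3) by simp
  have "\<exists>D :: ('a \<times> (nat \<Rightarrow> nat) \<times> (nat \<Rightarrow> nat) \<times> (nat list \<Rightarrow> nat)) set.
      D \<in> sets borel \<and> fst ` D = - P"
    unfolding P_def by (rule Compl_selected_points_projection[OF g K F \<tau>]) (rule inj)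
  then obtain D :: "('a \<times> (nat \<Rightarrow> nat) \<times> (nat \<Rightarrow> nat) \<times> (nat list \<Rightarrow> nat)) set"
    where D: "D \<in> sets borel" "fst ` D = - P" by blast
  have "coanalytic_set P"
    unfolding coanalytic_set_def D(2)[symmetric] by (rule projection_borel_analytic[OF D(1)])
  moreover have "generalised_haar_null P"
    unfolding generalised_haar_null_def
  proof (intro exI conjI allI)
    show "universally_measurable P"
      using projection_borel_universally_measurable[OF D(1)] unfolding D(2) by (rule universally_measurable_Compl)
    show "P \<subseteq> P" by simp
    show "borel_probability \<mu>" by (rule \<mu>)
    fix h
    \<comment> \<open>The shift \<open>h\<close> cancels in the difference of two such points, which
      lies in \<open>C - C\<close>. So both belong to the same \<open>z\<close>, which selects at
      most one point.\<close>
    have one: "b = b'" if b: "b \<in> (\<lambda>x. x + h) ` P \<inter> C" "b' \<in> (\<lambda>x. x + h) ` P \<inter> C" for b b'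
    proof -
      obtain z x where zx: "b = g z + x + h" "x \<in> K z" "selected z (\<tau> x)" "b \<in> C"
        using b(1) unfolding P_def selected_points_def by blast
      obtain z' x' where zx': "b' = g z' + x' + h" "x' \<in> K z'" "selected z' (\<tau> x')" "b' \<in> C"
        using b(2) unfolding P_def selected_points_def by blast
      have "z = z'" using sep[OF zx(2) zx'(2) zx(4) zx'(4)] zx(1) zx'(1) by simp
      then have "\<tau> x = \<tau> x'" using selected_unique zx(3) zx'(3) by blast
      then have "x = x'" by (metis \<kappa>\<tau>)
      with \<open>z = z'\<close> show ?thesis using zx(1) zx'(1) by simp
    qed
    obtain b where "(\<lambda>x. x + h) ` P \<inter> C \<subseteq> {b}" using one by blast
    then have "(\<lambda>x. x + h) ` P \<subseteq> - C \<union> {b}" by blast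
    moreover have "- C \<in> null_sets \<mu>" "{b} \<in> null_sets \<mu>"
      using C atomless by (simp_all add: null_sets_def sets compact_imp_closed borel_open open_Compl)
    then have "- C \<union> {b} \<in> null_sets \<mu>" by (rule null_sets.Un)
    ultimately show "(\<lambda>x. x + h) ` P \<in> null_sets (completion \<mu>)"
      unfolding null_sets_completion_iff2 by blast
  qed
  moreover have "\<not> haar_null P"
    unfolding P_def by (rule selected_points_not_haar_null[OF g K _ \<tau> \<kappa> \<kappa>\<tau>]) (rule cover)
  ultimately show ?thesis by blast
qed

lemma haar_null_subset:
  assumes "haar_null B" "P \<subseteq> B"
  shows "haar_null P"
  using assms unfolding haar_null_def by blast

theorem theorem1p8:
  assumes "\<not> locally_compact_space (euclidean :: 'a::{topological_ab_group_add, polish_space} topology)"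
  shows "\<not> (\<forall>X :: 'a set. generalised_haar_null X \<longrightarrow> haar_null X)
    \<and> (\<exists>P :: 'a set. coanalytic_set P \<and> generalised_haar_null P
          \<and> \<not> (\<exists>B \<in> sets borel. haar_null B \<and> P \<subseteq> B))"
proof -
  obtain P :: "'a set" where P: "coanalytic_set P" "generalised_haar_null P" "\<not> haar_null P"
    using coanalytic_generalised_haar_null_not_haar_null[OF assms] by blast
  then have "\<not> (\<exists>B \<in> sets borel. haar_null B \<and> P \<subseteq> B)"
    using haar_null_subset by blast
  with P show ?thesis by blast
qed

end
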